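(* Let $\mathcal U$ carry a marked contact Engel structure and let $(\omega^0,\dots,\omega^4)$ be an adapted coframe satisfying the structure equations (SE) of the context with functions $a,b,c,J,M,P$. On the $9$-dimensional bundle $\mathcal G^9\to\mathcal U$ with fibre coordinates $(\delta,s_4,s_5,s_7)$, $\delta s_5\ne0$, consider the five $1$-forms $$\begin{aligned} \theta^0&=-\delta^3\omega^0\\ \theta^1&=\tfrac{s_5^3(3Js_5s_7-a\delta)}{\delta}\omega^0+s_5^3\omega^1\\ \theta^2&=\tfrac{s_5(b\delta^2-2a\delta s_5s_7+3Js_5^2s_7^2)}{2\delta}\omega^0+s_5^2s_7\omega^1-\delta s_5\omega^2\\ \theta^3&=\tfrac{-c\delta^3+b\delta^2s_5s_7-a\delta s_5^2s_7^2+Js_5^3s_7^3}{\delta s_5}\omega^0+s_5s_7^2\omega^1-2\delta s_7\omega^2+\tfrac{\delta^2}{s_5}\omega^3\\ \theta^4&=s_4\omega^0+s_7^3\omega^1-\tfrac{3\delta s_7^2}{s_5}\omega^2+\tfrac{3\delta^2s_7}{s_5^2}\omega^3-\tfrac{\delta^3}{s_5^3}\omega^4 . \end{aligned}$$ These five forms can be supplemented to a coframe $(\theta^0,\theta^1,\theta^2,\theta^3,\theta^4,\theta^5,\theta^6,\theta^8,\theta^{12})$ on $\mathcal G^9$ which is uniquely determined by the fact that it satisfies $$\begin{aligned} d\theta^0=&-6\theta^0\wedge\theta^5+\theta^1\wedge\theta^4-3\theta^2\wedge\theta^3\\ d\theta^1=&-3\theta^1\wedge\theta^5-3\theta^1\wedge\theta^8+T^1{}_{02}\theta^0\wedge\theta^2+T^1{}_{03}\theta^0\wedge\theta^3+T^1{}_{04}\theta^0\wedge\theta^4+T^1{}_{06}\theta^0\wedge\theta^6+T^1{}_{24}\theta^2\wedge\theta^4\\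 d\theta^2=&\ \theta^1\wedge\theta^6-3\theta^2\wedge\theta^5-\theta^2\wedge\theta^8+T^2{}_{03}\theta^0\wedge\theta^3-T^2{}_{04}\theta^0\wedge\theta^4+T^2{}_{34}\theta^3\wedge\theta^4\\ d\theta^3=&\ 2\theta^2\wedge\theta^6-3\theta^3\wedge\theta^5+\theta^3\wedge\theta^8+T^3{}_{01}\theta^0\wedge\theta^1+T^3{}_{02}\theta^0\wedge\theta^2-T^3{}_{03}\theta^0\wedge\theta^3+T^3{}_{04}\theta^0\wedge\theta^4\\ d\theta^4=&\ 6\theta^0\wedge\theta^{12}+3\theta^3\wedge\theta^6-3\theta^4\wedge\theta^5+3\theta^4\wedge\theta^8 \end{aligned}$$ for some functions $T^i{}_{jk}$ on $\mathcal G^9$, together with the additional normalization that $d\theta^5$, when written with respect to the basis of $2$-forms $\theta^i\wedge\theta^j$, has zero coefficient at the $\theta^0\wedge\theta^1$ term.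
   Context: All objects are smooth and all considerations are local. A contact twisted cubic structure on a $5$-manifold $\mathcal M$ is a contact distribution $\mathcal C\subset T\mathcal M$ (rank $4$, locally $\mathcal C=\ker\alpha$ with $\alpha\wedge d\alpha\wedge d\alpha\ne0$) together with a subbundle $\gamma\subset\mathbb P(\mathcal C)$ whose fibres $\gamma_x$ are twisted cubics (in a suitable basis of $\mathcal C_x$, $\gamma_x=\{[s^3,s^2t,st^2,t^3]\}$) that are Legendrian: the tangent plane at each nonzero point of the cone $\hat\gamma_x\subset\mathcal C_x$ over $\gamma_x$ is isotropic for $d\alpha|_{\mathcal C_x}$. It is marked if a smooth section $\sigma:\mathcal M\to\gamma$ is given; $\ell^\sigma\subset\mathcal C$ is the corresponding line distribution. A coframe $(\omega^0,\dots,\omega^4)$ is adapted to the marked structure if $\mathcal C=\ker\omega^0$, $\hat\gamma$ is the set of vectors in $\mathcal C$ simultaneously null for $\omega^1\omega^3-(\omega^2)^2$, $\omega^2\omega^4-(\omega^3)^2$, $\omega^2\omega^3-\omega^1\omega^4$, and $\ell^\sigma=\ker(\omega^0,\omega^1,\omega^2,\omega^3)$. The contact Engel structure is the contact twisted cubic structure on open subsets of $\mathbb R^5$ given by $\alpha^0=dx^0+x^1dx^4-3x^2dx^3$, $\alpha^i=dx^i$: $\mathcal C=\ker\alpha^0$ and $\hat\gamma=$ common null vectors in $\mathcal C$ of $\alpha^1\alpha^3-(\alpha^2)^2$, $\alpha^2\alpha^4-(\alpha^3)^2$, $\alpha^2\alpha^3-\alpha^1\alpha^4$. A marked contact Engel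 structure is a marked contact twisted cubic structure whose underlying contact twisted cubic structure is locally equivalent to it. Locally it always admits an adapted coframe satisfying (SE): $$\begin{aligned} d\omega^0&=\omega^1\wedge\omega^4-3\omega^2\wedge\omega^3\\ d\omega^1&=\tfrac34(b^2-4ac+M-P)\,\omega^0\wedge\omega^2+3c\,\omega^1\wedge\omega^2-3a\,\omega^2\wedge\omega^3+3J\,\omega^2\wedge\omega^4\\ d\omega^2&=\tfrac12(b^2-4ac+M-P)\,\omega^0\wedge\omega^3+2c\,\omega^1\wedge\omega^3-2b\,\omega^2\wedge\omega^3+2J\,\omega^3\wedge\omega^4\\ d\omega^3&=\tfrac14(b^2-4ac+M-P)\,\omega^0\wedge\omega^4+c\,\omega^1\wedge\omega^4-b\,\omega^2\wedge\omega^4+a\,\omega^3\wedge\omega^4\\ d\omega^4&=0 \end{aligned}$$ for functions $a,b,c,J,M,P$. Forms on $\mathcal U$ are identified with their pullbacks to $\mathcal G^9$. *)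

theory Defs
  imports "HOL-Analysis.Analysis"
begin

section \<open>Smooth maps and differential forms\<close>

primrec Ck_on :: "nat \<Rightarrow> 'a::real_normed_vector set \<Rightarrow> ('a \<Rightarrow> 'b::real_normed_vector) \<Rightarrow> bool" where
  "Ck_on 0 S f \<longleftrightarrow> continuous_on S f"
| "Ck_on (Suc n) S f \<longleftrightarrow>
     (\<forall>x\<in>S. f differentiable (at x)) \<and>
     (\<forall>v. Ck_on n S (\<lambda>x. frechet_derivative f (at x) v))"

text \<open>Only used for open \<open>S\<close> in finite-dimensional spaces, where continuity of all directional
  derivatives is the same as continuity of the total derivative.\<close>

definition smooth_on :: "'a::real_normed_vector set \<Rightarrow> ('a \<Rightarrow> 'b::real_normed_vector) \<Rightarrow> bool" where
  "smooth_on S f \<longleftrightarrow> (\<forall>n. Ck_on n S f)"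

definition diffeo_between ::
  "'a::real_normed_vector set \<Rightarrow> 'b::real_normed_vector set \<Rightarrow> ('a \<Rightarrow> 'b) \<Rightarrow> bool" where
  "diffeo_between V W f \<longleftrightarrow> open V \<and> open W \<and> smooth_on V f \<and> f ` V = W \<and>
     (\<exists>g. smooth_on W g \<and> (\<forall>x\<in>V. g (f x) = x))"

type_synonym 'a one_form = "'a \<Rightarrow> ('a \<Rightarrow>\<^sub>L real)"

definition wedge ::
  "('a::real_normed_vector \<Rightarrow>\<^sub>L real) \<Rightarrow> ('a \<Rightarrow>\<^sub>L real) \<Rightarrow> 'a \<Rightarrow> 'a \<Rightarrow> real" where
  "wedge \<alpha> \<beta> u v =
     blinfun_apply \<alpha> u * blinfun_apply \<beta> v - blinfun_apply \<alpha> v * blinfun_apply \<beta> u"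

definition ext_d :: "'a::real_normed_vector one_form \<Rightarrow> 'a \<Rightarrow> 'a \<Rightarrow> 'a \<Rightarrow> real" where
  "ext_d \<alpha> x u v =
     blinfun_apply (frechet_derivative \<alpha> (at x) u) v -
     blinfun_apply (frechet_derivative \<alpha> (at x) v) u"

definition pullback ::
  "('a::real_normed_vector \<Rightarrow> 'b::real_normed_vector) \<Rightarrow> 'b one_form \<Rightarrow> 'a one_form" where
  "pullback f \<alpha> x = Blinfun (\<lambda>v. blinfun_apply (\<alpha> (f x)) (frechet_derivative f (at x) v))"

text \<open>The wedge product of a covector with two alternating bilinear forms, evaluated on
  \<open>v 0, \<dots>, v 4\<close>; the factor is \<open>1 / (1! 2! 2!)\<close>.\<close>

definition wedge_1_2_2 ::
  "('a \<Rightarrow> real) \<Rightarrow> ('a \<Rightarrow> 'a \<Rightarrow> real) \<Rightarrow> ('a \<Rightarrow> 'a \<Rightarrow> real) \<Rightarrow> (nat \<Rightarrow> 'a) \<Rightarrow> real" where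
  "wedge_1_2_2 \<alpha> \<beta> \<gamma> v =
     (\<Sum>\<pi> | \<pi> permutes {..<5::nat}.
        of_int (sign \<pi>) * \<alpha> (v (\<pi> 0)) * \<beta> (v (\<pi> 1)) (v (\<pi> 2)) * \<gamma> (v (\<pi> 3)) (v (\<pi> 4))) / 4"

definition basis_family :: "'i set \<Rightarrow> ('i \<Rightarrow> 'v::real_vector) \<Rightarrow> 'v set \<Rightarrow> bool" where
  "basis_family I e B \<longleftrightarrow> inj_on e I \<and> independent (e ` I) \<and> span (e ` I) = B"

definition coframe_on ::
  "'a::real_normed_vector set \<Rightarrow> nat set \<Rightarrow> (nat \<Rightarrow> 'a one_form) \<Rightarrow> bool" where
  "coframe_on S I \<omega> \<longleftrightarrow>
     (\<forall>i\<in>I. smooth_on S (\<omega> i)) \<and> (\<forall>x\<in>S. basis_family I (\<lambda>i. \<omega> i x) UNIV)"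


section \<open>Contact twisted cubic structures\<close>

text \<open>Since all considerations are local, the 5-manifold is an open subset of \<open>real^5\<close>.
  A distribution, the cone over a subbundle of its projectivisation, and a line distribution are
  given by the subset of the tangent space \<open>real^5\<close> that they determine at each point.\<close>

type_synonym vec5 = "real^5"
type_synonym fibre_sets = "vec5 \<Rightarrow> vec5 set"

definition contact_form_on :: "vec5 set \<Rightarrow> vec5 one_form \<Rightarrow> bool" where
  "contact_form_on V \<alpha> \<longleftrightarrow> smooth_on V \<alpha> \<and>
     (\<forall>x\<in>V. \<exists>v. wedge_1_2_2 (blinfun_apply (\<alpha> x)) (ext_d \<alpha> x) (ext_d \<alpha> x) v \<noteq> 0)"

definition local_contact_form :: "fibre_sets \<Rightarrow> vec5 set \<Rightarrow> vec5 one_form \<Rightarrow> bool" where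
  "local_contact_form C V \<alpha> \<longleftrightarrow> open V \<and> contact_form_on V \<alpha> \<and>
     (\<forall>x\<in>V. C x = {v. blinfun_apply (\<alpha> x) v = 0})"

definition contact_distribution :: "vec5 set \<Rightarrow> fibre_sets \<Rightarrow> bool" where
  "contact_distribution U C \<longleftrightarrow>
     (\<forall>x\<in>U. \<exists>V \<alpha>. x \<in> V \<and> V \<subseteq> U \<and> local_contact_form C V \<alpha>)"

definition cubic_point :: "(nat \<Rightarrow> vec5) \<Rightarrow> real \<Rightarrow> real \<Rightarrow> vec5" where
  "cubic_point e s t =
     s^3 *\<^sub>R e 0 + (s^2 * t) *\<^sub>R e 1 + (s * t^2) *\<^sub>R e 2 + t^3 *\<^sub>R e 3"

definition cubic_cone :: "(nat \<Rightarrow> vec5) \<Rightarrow> vec5 set" where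
  "cubic_cone e = {r *\<^sub>R cubic_point e s t | r s t. True}"

text \<open>The tangent plane of the cone along the ray through \<open>cubic_point e s t\<close>; as every real
  number is a cube, every nonzero point of the cone is itself some \<open>cubic_point e s t\<close> with
  \<open>(s, t) \<noteq> (0, 0)\<close>.\<close>

definition cubic_tangent_plane :: "(nat \<Rightarrow> vec5) \<Rightarrow> real \<Rightarrow> real \<Rightarrow> vec5 set" where
  "cubic_tangent_plane e s t =
     span {vector_derivative (\<lambda>r. cubic_point e r t) (at s),
           vector_derivative (\<lambda>r. cubic_point e s r) (at t)}"

text \<open>A smooth subbundle of twisted cubics: the basis putting the cubic in standard form can
  locally be chosen smoothly.\<close>

definition twisted_cubic_subbundle :: "vec5 set \<Rightarrow> fibre_sets \<Rightarrow> fibre_sets \<Rightarrow> bool" where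
  "twisted_cubic_subbundle U C K \<longleftrightarrow>
     (\<forall>x\<in>U. \<exists>V e. open V \<and> x \<in> V \<and> V \<subseteq> U \<and> (\<forall>i<4. smooth_on V (e i)) \<and>
        (\<forall>y\<in>V. basis_family {..<4::nat} (\<lambda>i. e i y) (C y) \<and> K y = cubic_cone (\<lambda>i. e i y)))"

definition legendrian :: "vec5 set \<Rightarrow> fibre_sets \<Rightarrow> fibre_sets \<Rightarrow> bool" where
  "legendrian U C K \<longleftrightarrow>
     (\<forall>V \<alpha> y e s t. V \<subseteq> U \<and> local_contact_form C V \<alpha> \<and> y \<in> V \<and>
        basis_family {..<4::nat} e (C y) \<and> K y = cubic_cone e \<and> (s, t) \<noteq> (0, 0) \<longrightarrow>
        (\<forall>u\<in>cubic_tangent_plane e s t. \<forall>v\<in>cubic_tangent_plane e s t. ext_d \<alpha> y u v = 0))"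

definition contact_twisted_cubic :: "vec5 set \<Rightarrow> fibre_sets \<Rightarrow> fibre_sets \<Rightarrow> bool" where
  "contact_twisted_cubic U C K \<longleftrightarrow>
     open U \<and> contact_distribution U C \<and> twisted_cubic_subbundle U C K \<and> legendrian U C K"

definition smooth_marking :: "vec5 set \<Rightarrow> fibre_sets \<Rightarrow> fibre_sets \<Rightarrow> bool" where
  "smooth_marking U K L \<longleftrightarrow>
     (\<forall>x\<in>U. \<exists>V \<xi>. open V \<and> x \<in> V \<and> V \<subseteq> U \<and> smooth_on V \<xi> \<and>
        (\<forall>y\<in>V. \<xi> y \<noteq> 0 \<and> \<xi> y \<in> K y \<and> L y = span {\<xi> y}))"

definition locally_equivalent ::
  "vec5 set \<Rightarrow> fibre_sets \<Rightarrow> fibre_sets \<Rightarrow> vec5 set \<Rightarrow> fibre_sets \<Rightarrow> fibre_sets \<Rightarrow> bool" where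
  "locally_equivalent U C K U' C' K' \<longleftrightarrow>
     (\<forall>x\<in>U. \<exists>V W \<phi>. x \<in> V \<and> V \<subseteq> U \<and> W \<subseteq> U' \<and> diffeo_between V W \<phi> \<and>
        (\<forall>y\<in>V. frechet_derivative \<phi> (at y) ` C y = C' (\<phi> y) \<and>
               frechet_derivative \<phi> (at y) ` K y = K' (\<phi> y)))"

definition null_cone :: "(nat \<Rightarrow> vec5 one_form) \<Rightarrow> fibre_sets" where
  "null_cone \<omega> x = {v. let w = (\<lambda>i. blinfun_apply (\<omega> i x) v) in
     w 0 = 0 \<and> w 1 * w 3 - (w 2)^2 = 0 \<and> w 2 * w 4 - (w 3)^2 = 0 \<and> w 2 * w 3 - w 1 * w 4 = 0}"

definition adapted_coframe ::
  "vec5 set \<Rightarrow> fibre_sets \<Rightarrow> fibre_sets \<Rightarrow> fibre_sets \<Rightarrow> (nat \<Rightarrow> vec5 one_form) \<Rightarrow> bool" where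
  "adapted_coframe U C K L \<omega> \<longleftrightarrow> coframe_on U {..4} \<omega> \<and>
     (\<forall>x\<in>U. C x = {v. blinfun_apply (\<omega> 0 x) v = 0} \<and>
            K x = null_cone \<omega> x \<and>
            L x = {v. \<forall>i\<in>{0,1,2,3}. blinfun_apply (\<omega> i x) v = 0})"


section \<open>The contact Engel structure\<close>

text \<open>The coordinates \<open>x\<^sup>0, \<dots>, x\<^sup>4\<close> are \<open>x $ 0, \<dots>, x $ 4\<close>; the index type \<open>5\<close> consists of the
  residues \<open>0, \<dots>, 4\<close>.\<close>

definition dx :: "5 \<Rightarrow> vec5 \<Rightarrow>\<^sub>L real" where
  "dx i = Blinfun (\<lambda>v. v $ i)"

definition engel_coframe :: "nat \<Rightarrow> vec5 one_form" where
  "engel_coframe i x =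
     (if i = 0 then dx 0 + (x $ 1) *\<^sub>R dx 4 - (3 * x $ 2) *\<^sub>R dx 3 else dx (of_nat i))"

definition engel_distribution :: fibre_sets where
  "engel_distribution x = {v. blinfun_apply (engel_coframe 0 x) v = 0}"

definition marked_contact_engel ::
  "vec5 set \<Rightarrow> fibre_sets \<Rightarrow> fibre_sets \<Rightarrow> fibre_sets \<Rightarrow> bool" where
  "marked_contact_engel U C K L \<longleftrightarrow>
     contact_twisted_cubic U C K \<and> smooth_marking U K L \<and>
     locally_equivalent U C K UNIV engel_distribution (null_cone engel_coframe)"

definition SE ::
  "vec5 set \<Rightarrow> (nat \<Rightarrow> vec5 one_form) \<Rightarrow> (vec5 \<Rightarrow> real) \<Rightarrow> (vec5 \<Rightarrow> real) \<Rightarrow> (vec5 \<Rightarrow> real) \<Rightarrow>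
   (vec5 \<Rightarrow> real) \<Rightarrow> (vec5 \<Rightarrow> real) \<Rightarrow> (vec5 \<Rightarrow> real) \<Rightarrow> bool" where
  "SE U \<omega> a b c J M P \<longleftrightarrow>
     (\<forall>x\<in>U. \<forall>u v.
        let w = (\<lambda>i j. wedge (\<omega> i x) (\<omega> j x) u v);
            Q = (b x)^2 - 4 * a x * c x + M x - P x
        in
        ext_d (\<omega> 0) x u v = w 1 4 - 3 * w 2 3 \<and>
        ext_d (\<omega> 1) x u v =
          3/4 * Q * w 0 2 + 3 * c x * w 1 2 - 3 * a x * w 2 3 + 3 * J x * w 2 4 \<and>
        ext_d (\<omega> 2) x u v =
          1/2 * Q * w 0 3 + 2 * c x * w 1 3 - 2 * b x * w 2 3 + 2 * J x * w 3 4 \<and>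
        ext_d (\<omega> 3) x u v =
          1/4 * Q * w 0 4 + c x * w 1 4 - b x * w 2 4 + a x * w 3 4 \<and>
        ext_d (\<omega> 4) x u v = 0)"


section \<open>The 9-dimensional bundle\<close>

text \<open>Points are \<open>(x, \<delta>, s\<^sub>4, s\<^sub>5, s\<^sub>7)\<close>; the bundle projection is \<open>fst\<close>.\<close>

type_synonym pt9 = "vec5 \<times> real \<times> real \<times> real \<times> real"

definition G9 :: "vec5 set \<Rightarrow> pt9 set" where
  "G9 U = {(x, \<delta>, s4, s5, s7). x \<in> U \<and> \<delta> * s5 \<noteq> 0}"

definition I9 :: "nat set" where
  "I9 = {0, 1, 2, 3, 4, 5, 6, 8, 12}"

definition theta ::
  "(nat \<Rightarrow> vec5 one_form) \<Rightarrow> (vec5 \<Rightarrow> real) \<Rightarrow> (vec5 \<Rightarrow> real) \<Rightarrow> (vec5 \<Rightarrow> real) \<Rightarrow>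
   (vec5 \<Rightarrow> real) \<Rightarrow> nat \<Rightarrow> pt9 one_form" where
  "theta \<omega> a b c J i = (\<lambda>(x, \<delta>, s4, s5, s7).
     let w = (\<lambda>j. pullback fst (\<omega> j) (x, \<delta>, s4, s5, s7));
         a = a x; b = b x; c = c x; J = J x
     in
     if i = 0 then
       (- (\<delta>^3)) *\<^sub>R w 0
     else if i = 1 then
       (s5^3 * (3 * J * s5 * s7 - a * \<delta>) / \<delta>) *\<^sub>R w 0 + s5^3 *\<^sub>R w 1
     else if i = 2 then
       (s5 * (b * \<delta>^2 - 2 * a * \<delta> * s5 * s7 + 3 * J * s5^2 * s7^2) / (2 * \<delta>)) *\<^sub>R w 0
       + (s5^2 * s7) *\<^sub>R w 1 - (\<delta> * s5) *\<^sub>R w 2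
     else if i = 3 then
       ((- c * \<delta>^3 + b * \<delta>^2 * s5 * s7 - a * \<delta> * s5^2 * s7^2 + J * s5^3 * s7^3) / (\<delta> * s5)) *\<^sub>R w 0
       + (s5 * s7^2) *\<^sub>R w 1 - (2 * \<delta> * s7) *\<^sub>R w 2 + (\<delta>^2 / s5) *\<^sub>R w 3
     else
       s4 *\<^sub>R w 0 + s7^3 *\<^sub>R w 1 - (3 * \<delta> * s7^2 / s5) *\<^sub>R w 2
       + (3 * \<delta>^2 * s7 / s5^2) *\<^sub>R w 3 - (\<delta>^3 / s5^3) *\<^sub>R w 4)"

text \<open>\<open>T i j k\<close> is the coefficient with upper index \<open>i\<close> and lower indices \<open>j k\<close>.\<close>

definition structure_equations ::
  "pt9 set \<Rightarrow> (nat \<Rightarrow> pt9 one_form) \<Rightarrow> (nat \<Rightarrow> nat \<Rightarrow> nat \<Rightarrow> pt9 \<Rightarrow> real) \<Rightarrow> bool" where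
  "structure_equations S \<theta> T \<longleftrightarrow>
     (\<forall>p\<in>S. \<forall>u v.
        let w = (\<lambda>i j. wedge (\<theta> i p) (\<theta> j p) u v) in
        ext_d (\<theta> 0) p u v = - 6 * w 0 5 + w 1 4 - 3 * w 2 3 \<and>
        ext_d (\<theta> 1) p u v = - 3 * w 1 5 - 3 * w 1 8
          + T 1 0 2 p * w 0 2 + T 1 0 3 p * w 0 3 + T 1 0 4 p * w 0 4 + T 1 0 6 p * w 0 6
          + T 1 2 4 p * w 2 4 \<and>
        ext_d (\<theta> 2) p u v = w 1 6 - 3 * w 2 5 - w 2 8
          + T 2 0 3 p * w 0 3 - T 2 0 4 p * w 0 4 + T 2 3 4 p * w 3 4 \<and>
        ext_d (\<theta> 3) p u v = 2 * w 2 6 - 3 * w 3 5 + w 3 8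
          + T 3 0 1 p * w 0 1 + T 3 0 2 p * w 0 2 - T 3 0 3 p * w 0 3 + T 3 0 4 p * w 0 4 \<and>
        ext_d (\<theta> 4) p u v = 6 * w 0 12 + 3 * w 3 6 - 3 * w 4 5 + 3 * w 4 8)"

text \<open>\<open>k i j\<close> are the coefficients of the 2-form in the basis of wedge products of the coframe.\<close>

definition zero_coeff_01 :: "pt9 set \<Rightarrow> (nat \<Rightarrow> pt9 one_form) \<Rightarrow> (pt9 \<Rightarrow> pt9 \<Rightarrow> pt9 \<Rightarrow> real) \<Rightarrow> bool" where
  "zero_coeff_01 S \<theta> \<Omega> \<longleftrightarrow>
     (\<forall>p\<in>S. \<exists>k :: nat \<Rightarrow> nat \<Rightarrow> real. k 0 1 = 0 \<and>
        (\<forall>u v. \<Omega> p u v =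
           (\<Sum>(i, j) | i \<in> I9 \<and> j \<in> I9 \<and> i < j. k i j * wedge (\<theta> i p) (\<theta> j p) u v)))"

definition normalized_coframe ::
  "vec5 set \<Rightarrow> (nat \<Rightarrow> vec5 one_form) \<Rightarrow> (vec5 \<Rightarrow> real) \<Rightarrow> (vec5 \<Rightarrow> real) \<Rightarrow> (vec5 \<Rightarrow> real) \<Rightarrow>
   (vec5 \<Rightarrow> real) \<Rightarrow> (nat \<Rightarrow> pt9 one_form) \<Rightarrow> bool" where
  "normalized_coframe U \<omega> a b c J \<theta> \<longleftrightarrow>
     coframe_on (G9 U) I9 \<theta> \<and>
     (\<forall>i\<in>{0..4}. \<forall>p\<in>G9 U. \<theta> i p = theta \<omega> a b c J i p) \<and>
     (\<exists>T. (\<forall>i j k. smooth_on (G9 U) (T i j k)) \<and> structure_equations (G9 U) \<theta> T) \<and>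
     zero_coeff_01 (G9 U) \<theta> (ext_d (\<theta> 5))"

end

theory Submission
  imports Defs
begin

text \<open>The fibre group acts on \<open>\<theta>\<^sup>0, \<dots>, \<theta>\<^sup>4\<close> linearly, so contracting \<open>d\<theta>\<^sup>i\<close> with a vertical vector gives
  a combination of the \<open>\<theta>\<^sup>j\<close>. Hence only the coefficients of \<open>d\<theta>\<^sup>i\<close> at \<open>\<theta>\<^sup>j \<and> \<theta>\<^sup>k\<close> with
  \<open>j, k \<le> 4\<close> have to be normalized, by adding combinations of \<open>\<theta>\<^sup>0, \<dots>, \<theta>\<^sup>4\<close> to the vertical forms.
  For \<open>j, k \<ge> 1\<close> they involve no derivatives of \<open>a, b, c, J\<close>, because \<open>\<omega>\<^sup>0\<close> vanishes on the corresponding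
  dual vectors; that these coefficients are compatible with the required shape is a finite check.
  The coefficients with \<open>j = 0\<close> that remain are solved for linearly.

  The equations leave \<open>\<theta>\<^sup>1\<^sup>2\<close> undetermined up to a multiple \<open>m \<theta>\<^sup>0\<close>. The coefficient of \<open>\<theta>\<^sup>1\<close> in
  \<open>\<theta>\<^sup>5\<close> is \<open>s\<^sub>4 / (6 \<delta>\<^sup>3)\<close>, so \<open>d\<theta>\<^sup>5\<close> contains \<open>\<theta>\<^sup>1\<^sup>2 \<and> \<theta>\<^sup>1\<close> with coefficient \<open>1\<close>, and
  the normalization of its \<open>\<theta>\<^sup>0 \<and> \<theta>\<^sup>1\<close> coefficient fixes \<open>m\<close>.\<close>

section \<open>Smooth maps on open sets\<close>

lemma frechet_derivative_cong_open:
  assumes "open S" "x \<in> S" "\<And>y. y \<in> S \<Longrightarrow> f y = g y" "f differentiable (at x)"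
  shows "g differentiable (at x)" "frechet_derivative g (at x) = frechet_derivative f (at x)"
proof -
  have "(g has_derivative frechet_derivative f (at x)) (at x)"
    using assms
    by (metis frechet_derivative_works has_derivative_transform_within_open)
  then show "g differentiable (at x)" "frechet_derivative g (at x) = frechet_derivative f (at x)"
    by (auto simp: differentiable_def dest: frechet_derivative_at)
qed

lemma Ck_on_cong_open:
  assumes "open S"
  shows "Ck_on n S f \<Longrightarrow> (\<And>x. x \<in> S \<Longrightarrow> f x = g x) \<Longrightarrow> Ck_on n S g"
proof (induction n arbitrary: f g)
  case 0
  then show ?case using continuous_on_cong by fastforce
next
  case (Suc n)
  show ?case
    unfolding Ck_on.simps
  proof (intro conjI ballI allI)
    have diff: "f differentiable (at x)" if "x \<in> S" for x
      using Suc.prems(1) that by simp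
    note eq = Suc.prems(2)
    show "g differentiable (at x)" if "x \<in> S" for x
      by (rule frechet_derivative_cong_open(1)[OF assms that eq diff[OF that]])
    have "frechet_derivative f (at x) v = frechet_derivative g (at x) v" if "x \<in> S" for x v
      by (rule fun_cong, rule sym, rule frechet_derivative_cong_open(2)[OF assms that eq diff[OF that]])
    then show "Ck_on n S (\<lambda>x. frechet_derivative g (at x) v)" for v
      by (rule Suc.IH[rotated]) (use Suc.prems(1) in simp_all)
  qed
qed

text \<open>Any family of derivatives may serve: on an open set it agrees with
  \<open>frechet_derivative\<close>, and congruence carries the class over. The inductions below can
  then use explicit derivative formulas.\<close>

lemma Ck_on_SucI:
  assumes "open S" "\<And>x. x \<in> S \<Longrightarrow> (f has_derivative f' x) (at x)"
    "\<And>v. Ck_on n S (\<lambda>x. f' x v)"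
  shows "Ck_on (Suc n) S f"
  unfolding Ck_on.simps
proof (intro conjI ballI allI)
  show "f differentiable (at x)" if "x \<in> S" for x
    using assms(2)[OF that] by (auto simp: differentiable_def)
  show "Ck_on n S (\<lambda>x. frechet_derivative f (at x) v)" for v
    using assms(2) frechet_derivative_at
    by (intro Ck_on_cong_open[OF assms(1) assms(3)[of v]]) fastforce
qed

lemma Ck_on_SucD:
  assumes "Ck_on (Suc n) S f"
  shows "x \<in> S \<Longrightarrow> (f has_derivative frechet_derivative f (at x)) (at x)"
    "Ck_on n S (\<lambda>x. frechet_derivative f (at x) v)"
  using assms by (auto simp: frechet_derivative_works)

lemma Ck_on_Suc_imp: "Ck_on (Suc n) S f \<Longrightarrow> Ck_on n S f"
proof (induction n arbitrary: f)
  case 0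
  then have "f differentiable_on S"
    by (auto simp: differentiable_on_def differentiable_at_withinI)
  then show ?case by (simp add: differentiable_imp_continuous_on)
qed simp

lemma Ck_on_const: "open S \<Longrightarrow> Ck_on n S (\<lambda>x. c)"
  by (induction n arbitrary: c)
    (auto intro!: Ck_on_SucI[where f' = "\<lambda>_ _. 0"] simp del: Ck_on.simps(2))

lemma Ck_on_linear:
  assumes "open S" "bounded_linear L"
  shows "Ck_on n S L"
proof (cases n)
  case 0
  then show ?thesis by (simp add: assms(2) linear_continuous_on)
next
  case (Suc m)
  then show ?thesis
    by (auto intro!: Ck_on_SucI[where f' = "\<lambda>_. L"] Ck_on_const assms
        bounded_linear_imp_has_derivative simp del: Ck_on.simps(2))
qed

lemma Ck_on_add:
  assumes "open S"
  shows "Ck_on n S f \<Longrightarrow> Ck_on n S g \<Longrightarrow> Ck_on n S (\<lambda>x. f x + g x)"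
proof (induction n arbitrary: f g)
  case (Suc n)
  show ?case
    by (rule Ck_on_SucI[OF assms])
      (auto intro!: has_derivative_add Suc.IH Ck_on_SucD[OF Suc.prems(1)] Ck_on_SucD[OF Suc.prems(2)]
        simp del: Ck_on.simps)
qed (auto intro: continuous_on_add)

text \<open>The derivative is a sum of two products of the same kind, each pairing one factor with a
  directional derivative of the other. The undifferentiated factor is weakened by
  \<open>Ck_on_Suc_imp\<close> before the induction hypothesis applies. Multiplication, scaling,
  evaluation of covectors and composition are instances.\<close>

lemma Ck_on_bilinear:
  assumes "open S" "bounded_bilinear B"
  shows "Ck_on n S f \<Longrightarrow> Ck_on n S g \<Longrightarrow> Ck_on n S (\<lambda>x. B (f x) (g x))"
proof (induction n arbitrary: f g)
  case 0
  then show ?case by (simp add: assms(2) bounded_bilinear.continuous_on)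
next
  case (Suc n)
  show ?case
    by (rule Ck_on_SucI[OF assms(1) bounded_bilinear.FDERIV[OF assms(2)
            Ck_on_SucD(1)[OF Suc.prems(1)] Ck_on_SucD(1)[OF Suc.prems(2)]]])
      (auto intro!: Ck_on_add[OF assms(1)] Suc.IH Ck_on_SucD(2)[OF Suc.prems(1)]
        Ck_on_SucD(2)[OF Suc.prems(2)] Ck_on_Suc_imp[OF Suc.prems(1)] Ck_on_Suc_imp[OF Suc.prems(2)]
        simp del: Ck_on.simps)
qed

lemma Ck_on_inverse:
  fixes f :: "'a::real_normed_vector \<Rightarrow> real"
  assumes "open S" "\<And>x. x \<in> S \<Longrightarrow> f x \<noteq> 0"
  shows "Ck_on n S f \<Longrightarrow> Ck_on n S (\<lambda>x. inverse (f x))"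
proof (induction n)
  case 0
  then show ?case using assms by (auto intro!: continuous_on_inverse)
next
  case (Suc n)
  note mult = Ck_on_bilinear[OF assms(1) bounded_bilinear_mult]
  have "Ck_on n S (\<lambda>x. - 1 * (inverse (f x) * frechet_derivative f (at x) v * inverse (f x)))" for v
    by (intro mult Ck_on_const assms(1) Suc.IH Ck_on_Suc_imp[OF Suc.prems] Ck_on_SucD(2)[OF Suc.prems])
  then show ?case
    by (intro Ck_on_SucI[OF assms(1) Deriv.has_derivative_inverse[OF assms(2) Ck_on_SucD(1)[OF Suc.prems]]])
      simp_all
qed

text \<open>A directional derivative of the composite is the derivative of \<open>f\<close> in the
  fixed direction \<open>L v\<close>, again composed with \<open>L\<close>, so the induction closes.
  The instance needed is the bundle projection \<open>fst\<close>.\<close>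

lemma Ck_on_comp_linear:
  assumes "open S" "open T" "bounded_linear L" "\<And>x. x \<in> S \<Longrightarrow> L x \<in> T"
  shows "Ck_on n T f \<Longrightarrow> Ck_on n S (\<lambda>x. f (L x))"
proof (induction n arbitrary: f)
  case 0
  then show ?case
    using continuous_on_compose2[of T f S L] assms(3,4) linear_continuous_on
    by (auto simp: image_subset_iff)
next
  case (Suc n)
  have "((\<lambda>x. f (L x)) has_derivative (\<lambda>v. frechet_derivative f (at (L x)) (L v))) (at x)"
    if "x \<in> S" for x
    by (rule has_derivative_compose[OF bounded_linear_imp_has_derivative[OF assms(3)]])
      (use Ck_on_SucD(1)[OF Suc.prems] assms(4) that in auto)
  then show ?case
    by (rule Ck_on_SucI[OF assms(1)]) (auto intro!: Suc.IH Ck_on_SucD(2)[OF Suc.prems])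
qed

section \<open>Closure properties of smooth functions\<close>

named_theorems smooth_intros

lemma smooth_on_differentiable: "smooth_on S f \<Longrightarrow> x \<in> S \<Longrightarrow> f differentiable (at x)"
  unfolding smooth_on_def by (metis Ck_on.simps(2))

lemma smooth_on_cong:
  "smooth_on S f \<Longrightarrow> open S \<Longrightarrow> (\<And>x. x \<in> S \<Longrightarrow> f x = g x) \<Longrightarrow> smooth_on S g"
  unfolding smooth_on_def using Ck_on_cong_open by blast

lemma smooth_on_directional:
  "smooth_on S f \<Longrightarrow> smooth_on S (\<lambda>x. frechet_derivative f (at x) v)"
  unfolding smooth_on_def by (metis Ck_on.simps(2))

lemma smooth_on_const [smooth_intros]: "open S \<Longrightarrow> smooth_on S (\<lambda>x. c)"
  unfolding smooth_on_def by (simp add: Ck_on_const)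

lemma smooth_on_linear: "bounded_linear L \<Longrightarrow> open S \<Longrightarrow> smooth_on S L"
  unfolding smooth_on_def by (simp add: Ck_on_linear)

lemma smooth_on_add [smooth_intros]:
  "open S \<Longrightarrow> smooth_on S f \<Longrightarrow> smooth_on S g \<Longrightarrow> smooth_on S (\<lambda>x. f x + g x)"
  unfolding smooth_on_def by (simp add: Ck_on_add)

lemma smooth_on_bilinear:
  "bounded_bilinear B \<Longrightarrow> open S \<Longrightarrow> smooth_on S f \<Longrightarrow> smooth_on S g \<Longrightarrow>
    smooth_on S (\<lambda>x. B (f x) (g x))"
  unfolding smooth_on_def by (simp add: Ck_on_bilinear)

lemmas smooth_on_mult [smooth_intros] =
  smooth_on_bilinear[OF bounded_bilinear_mult[where 'a = real]]
lemmas smooth_on_scaleR [smooth_intros] = smooth_on_bilinear[OF bounded_bilinear_scaleR]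
lemmas smooth_on_blinfun_apply [smooth_intros] = smooth_on_bilinear[OF bounded_bilinear_blinfun_apply]

lemma smooth_on_inverse [smooth_intros]:
  fixes f :: "'a::real_normed_vector \<Rightarrow> real"
  shows "open S \<Longrightarrow> smooth_on S f \<Longrightarrow> (\<And>x. x \<in> S \<Longrightarrow> f x \<noteq> 0) \<Longrightarrow> smooth_on S (\<lambda>x. inverse (f x))"
  unfolding smooth_on_def by (simp add: Ck_on_inverse)

lemma smooth_on_divide [smooth_intros]:
  fixes f :: "'a::real_normed_vector \<Rightarrow> real"
  shows "open S \<Longrightarrow> smooth_on S f \<Longrightarrow> smooth_on S g \<Longrightarrow> (\<And>x. x \<in> S \<Longrightarrow> g x \<noteq> 0) \<Longrightarrow>
    smooth_on S (\<lambda>x. f x / g x)"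
  unfolding divide_inverse by (intro smooth_intros) auto

lemma smooth_on_minus [smooth_intros]: "open S \<Longrightarrow> smooth_on S f \<Longrightarrow> smooth_on S (\<lambda>x. - f x)"
  using smooth_on_scaleR[of S "\<lambda>_. - 1" f] by (auto intro: smooth_intros)

lemma smooth_on_diff [smooth_intros]:
  "open S \<Longrightarrow> smooth_on S f \<Longrightarrow> smooth_on S g \<Longrightarrow> smooth_on S (\<lambda>x. f x - g x)"
  using smooth_on_add[OF _ _ smooth_on_minus, of S f g] by simp

lemma smooth_on_power [smooth_intros]:
  fixes f :: "'a::real_normed_vector \<Rightarrow> real"
  shows "open S \<Longrightarrow> smooth_on S f \<Longrightarrow> smooth_on S (\<lambda>x. f x ^ n)"
  by (induction n) (auto intro: smooth_intros)

lemma smooth_on_sum [smooth_intros]: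
  "open S \<Longrightarrow> (\<And>i. i \<in> I \<Longrightarrow> smooth_on S (f i)) \<Longrightarrow> smooth_on S (\<lambda>x. \<Sum>i\<in>I. f i x)"
  by (induction I rule: infinite_finite_induct) (auto intro: smooth_intros)

lemma smooth_on_prod [smooth_intros]:
  fixes f :: "'i \<Rightarrow> 'a::real_normed_vector \<Rightarrow> real"
  shows "open S \<Longrightarrow> (\<And>i. i \<in> I \<Longrightarrow> smooth_on S (f i)) \<Longrightarrow> smooth_on S (\<lambda>x. \<Prod>i\<in>I. f i x)"
  by (induction I rule: infinite_finite_induct) (auto intro: smooth_intros)

lemma smooth_on_if:
  "(Q \<Longrightarrow> smooth_on S f) \<Longrightarrow> (\<not> Q \<Longrightarrow> smooth_on S g) \<Longrightarrow> smooth_on S (\<lambda>x. if Q then f x else g x)"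
  by (cases Q) simp_all

lemma smooth_on_comp_linear:
  "bounded_linear L \<Longrightarrow> open S \<Longrightarrow> open T \<Longrightarrow> (\<And>x. x \<in> S \<Longrightarrow> L x \<in> T) \<Longrightarrow> smooth_on T f \<Longrightarrow>
    smooth_on S (\<lambda>x. f (L x))"
  unfolding smooth_on_def by (auto intro: Ck_on_comp_linear)

lemma smooth_on_linear_comp:
  assumes "bounded_linear L" "open S" "smooth_on S f"
  shows "smooth_on S (\<lambda>x. L (f x))"
proof -
  have "smooth_on S (\<lambda>x. blinfun_apply (Blinfun L) (f x))"
    by (intro smooth_intros assms)
  then show ?thesis by (simp add: bounded_linear_Blinfun_apply assms(1))
qed

lemma smooth_on_Pair [smooth_intros]:
  assumes "open S" "smooth_on S f" "smooth_on S g"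
  shows "smooth_on S (\<lambda>x. (f x, g x))"
proof -
  have "smooth_on S (\<lambda>x. (f x, 0) + (0, g x))"
    by (intro smooth_on_add assms smooth_on_linear_comp[of "\<lambda>y. (y, 0)"]
        smooth_on_linear_comp[of "\<lambda>y. (0, y)"])
      (auto intro: bounded_linear_intros bounded_linear_Pair)
  then show ?thesis by simp
qed

text \<open>\<open>smooth_on\<close> controls derivatives in constant directions only. Expanding the
  moving direction \<open>X x\<close> in the standard basis reduces to these, by linearity of the
  derivative.\<close>

lemma smooth_on_derivative_along:
  fixes f :: "'a::euclidean_space \<Rightarrow> 'b::real_normed_vector"
  assumes "open S" "smooth_on S f" "smooth_on S X"
  shows "smooth_on S (\<lambda>x. frechet_derivative f (at x) (X x))"
proof -
  have "smooth_on S (\<lambda>x. \<Sum>b\<in>Basis. (X x \<bullet> b) *\<^sub>R frechet_derivative f (at x) b)"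
    by (intro smooth_intros smooth_on_directional assms
        smooth_on_linear_comp[of "\<lambda>v. v \<bullet> _"] bounded_linear_inner_left)
  moreover have "(\<Sum>b\<in>Basis. (X x \<bullet> b) *\<^sub>R frechet_derivative f (at x) b) =
      frechet_derivative f (at x) (X x)" if "x \<in> S" for x
  proof -
    have "linear (frechet_derivative f (at x))"
      using assms(2) that by (simp add: linear_frechet_derivative smooth_on_differentiable)
    then show ?thesis
      by (subst (3) euclidean_representation[symmetric]) (simp only: linear_sum linear_scale)
  qed
  ultimately show ?thesis using smooth_on_cong[OF _ assms(1)] by fastforce
qed

section \<open>Calculus of one-forms\<close>

lemma smooth_on_ext_d [smooth_intros]:
  fixes \<alpha> :: "'a::euclidean_space one_form"
  assumes "open S" "smooth_on S \<alpha>" "smooth_on S X" "smooth_on S Y"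
  shows "smooth_on S (\<lambda>x. ext_d \<alpha> x (X x) (Y x))"
  unfolding ext_d_def by (intro smooth_intros smooth_on_derivative_along assms)

lemma ext_d_cong_open:
  assumes "open S" "x \<in> S" "\<And>y. y \<in> S \<Longrightarrow> \<alpha> y = \<beta> y" "\<alpha> differentiable (at x)"
  shows "ext_d \<beta> x = ext_d \<alpha> x"
  using frechet_derivative_cong_open(2)[OF assms] by (simp add: ext_d_def fun_eq_iff)

lemma ext_d_bilinear:
  assumes "\<alpha> differentiable (at x)"
  shows "ext_d \<alpha> x (u + u') v = ext_d \<alpha> x u v + ext_d \<alpha> x u' v"
    "ext_d \<alpha> x (r *\<^sub>R u) v = r * ext_d \<alpha> x u v"
    "ext_d \<alpha> x v (u + u') = ext_d \<alpha> x v u + ext_d \<alpha> x v u'"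
    "ext_d \<alpha> x v (r *\<^sub>R u) = r * ext_d \<alpha> x v u"
    "ext_d \<alpha> x (u - u') v = ext_d \<alpha> x u v - ext_d \<alpha> x u' v"
    "ext_d \<alpha> x v (u - u') = ext_d \<alpha> x v u - ext_d \<alpha> x v u'"
  using linear_frechet_derivative[OF assms]
  by (simp_all add: ext_d_def linear_add linear_diff linear_scale blinfun.bilinear_simps algebra_simps)

lemma ext_d_skew: "ext_d \<alpha> x v u = - ext_d \<alpha> x u v"
  by (simp add: ext_d_def)

lemma ext_d_has_derivative:
  assumes "(\<alpha> has_derivative D) (at x)"
  shows "ext_d \<alpha> x u v = blinfun_apply (D u) v - blinfun_apply (D v) u"
  using frechet_derivative_at[OF assms] by (simp add: ext_d_def)

lemma ext_d_scaleR:
  fixes f :: "'a::real_normed_vector \<Rightarrow> real"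
  assumes "(f has_derivative f') (at x)" "\<alpha> differentiable (at x)"
  shows "ext_d (\<lambda>y. f y *\<^sub>R \<alpha> y) x u v =
    f' u * blinfun_apply (\<alpha> x) v - f' v * blinfun_apply (\<alpha> x) u + f x * ext_d \<alpha> x u v"
proof -
  have "(\<alpha> has_derivative frechet_derivative \<alpha> (at x)) (at x)"
    using assms(2) by (simp add: frechet_derivative_works)
  from ext_d_has_derivative[OF has_derivative_scaleR[OF assms(1) this]] show ?thesis
    by (simp add: ext_d_def blinfun.bilinear_simps algebra_simps)
qed

lemma ext_d_add:
  assumes "\<alpha> differentiable (at x)" "\<beta> differentiable (at x)"
  shows "ext_d (\<lambda>y. \<alpha> y + \<beta> y) x u v = ext_d \<alpha> x u v + ext_d \<beta> x u v"
proof -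
  have "((\<lambda>y. \<alpha> y + \<beta> y) has_derivative
      (\<lambda>w. frechet_derivative \<alpha> (at x) w + frechet_derivative \<beta> (at x) w)) (at x)"
    using assms by (intro has_derivative_add) (simp_all add: frechet_derivative_works[symmetric])
  from ext_d_has_derivative[OF this] show ?thesis
    by (simp add: ext_d_def blinfun.bilinear_simps)
qed

lemma ext_d_sum:
  assumes "\<And>i. i \<in> I \<Longrightarrow> \<alpha> i differentiable (at x)"
  shows "ext_d (\<lambda>y. \<Sum>i\<in>I. \<alpha> i y) x u v = (\<Sum>i\<in>I. ext_d (\<alpha> i) x u v)"
proof -
  have "((\<lambda>y. \<Sum>i\<in>I. \<alpha> i y) has_derivative
      (\<lambda>w. \<Sum>i\<in>I. frechet_derivative (\<alpha> i) (at x) w)) (at x)"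
    using assms by (intro has_derivative_sum) (simp add: frechet_derivative_works[symmetric])
  from ext_d_has_derivative[OF this] show ?thesis
    by (simp add: ext_d_def blinfun.sum_left sum_subtractf)
qed

lemma frechet_derivative_linear:
  "bounded_linear L \<Longrightarrow> frechet_derivative L (at x) = L"
  by (metis bounded_linear_imp_has_derivative frechet_derivative_at)

lemma pullback_linear:
  assumes "bounded_linear L"
  shows "pullback L \<alpha> = (\<lambda>p. \<alpha> (L p) o\<^sub>L Blinfun L)"
proof
  fix p
  have "bounded_linear (\<lambda>v. blinfun_apply (\<alpha> (L p)) (L v))"
    by (intro bounded_linear_compose[OF blinfun.bounded_linear_right assms])
  then show "pullback L \<alpha> p = \<alpha> (L p) o\<^sub>L Blinfun L"
    using assms
    by (intro blinfun_eqI)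
      (simp add: pullback_def frechet_derivative_linear bounded_linear_Blinfun_apply)
qed

lemma pullback_linear_apply:
  "bounded_linear L \<Longrightarrow> blinfun_apply (pullback L \<alpha> p) v = blinfun_apply (\<alpha> (L p)) (L v)"
  by (simp add: pullback_linear bounded_linear_Blinfun_apply)

lemma smooth_on_pullback_linear:
  assumes "bounded_linear L" "open S" "open T" "\<And>x. x \<in> S \<Longrightarrow> L x \<in> T" "smooth_on T \<alpha>"
  shows "smooth_on S (pullback L \<alpha>)"
  unfolding pullback_linear[OF assms(1)]
  by (intro smooth_on_bilinear[OF bounded_bilinear_blinfun_compose]
      smooth_on_comp_linear[OF assms] smooth_on_const assms(2))

lemma ext_d_pullback_linear:
  assumes "bounded_linear L" "\<alpha> differentiable (at (L p))"
  shows "ext_d (pullback L \<alpha>) p u v = ext_d \<alpha> (L p) (L u) (L v)"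
proof -
  have "((\<lambda>p. \<alpha> (L p)) has_derivative (\<lambda>v. frechet_derivative \<alpha> (at (L p)) (L v))) (at p)"
    by (rule has_derivative_compose[OF bounded_linear_imp_has_derivative[OF assms(1)]])
      (use assms(2) in \<open>simp add: frechet_derivative_works\<close>)
  from bounded_linear.has_derivative[OF bounded_bilinear.bounded_linear_left
      [OF bounded_bilinear_blinfun_compose] this]
  have "(pullback L \<alpha> has_derivative
      (\<lambda>v. frechet_derivative \<alpha> (at (L p)) (L v) o\<^sub>L Blinfun L)) (at p)"
    unfolding pullback_linear[OF assms(1)] .
  from ext_d_has_derivative[OF this] show ?thesis
    by (simp add: ext_d_def bounded_linear_Blinfun_apply assms(1))
qed

section \<open>Dual frames\<close>

text \<open>Completeness is a clause of its own, so that vectors can be expanded without a dimension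
  count.\<close>

definition dual_frame :: "'i set \<Rightarrow> ('i \<Rightarrow> 'a::real_normed_vector \<Rightarrow>\<^sub>L real) \<Rightarrow> ('i \<Rightarrow> 'a) \<Rightarrow> bool" where
  "dual_frame I e f \<longleftrightarrow>
     (\<forall>i\<in>I. \<forall>j\<in>I. blinfun_apply (e i) (f j) = (if i = j then 1 else 0)) \<and>
     (\<forall>v. v = (\<Sum>i\<in>I. blinfun_apply (e i) v *\<^sub>R f i))"

lemma dual_frameD:
  assumes "dual_frame I e f"
  shows "i \<in> I \<Longrightarrow> j \<in> I \<Longrightarrow> blinfun_apply (e i) (f j) = (if i = j then 1 else 0)"
    "v = (\<Sum>i\<in>I. blinfun_apply (e i) v *\<^sub>R f i)"
  using assms by (auto simp: dual_frame_def)

text \<open>Evaluation on \<open>f k\<close> isolates the coefficient of \<open>e k\<close>, which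
  gives independence. By completeness every covector is the sum of its values on the
  \<open>f i\<close> times \<open>e i\<close>.\<close>

lemma dual_frame_imp_basis:
  assumes "finite I" "dual_frame I e f"
  shows "basis_family I e UNIV"
proof -
  note d = dual_frameD[OF assms(2)]
  have inj: "inj_on e I"
    by (rule inj_onI) (metis d(1) zero_neq_one)
  have "independent (e ` I)"
    unfolding dependent_finite[OF finite_imageI[OF assms(1)]]
  proof (clarsimp simp: sum.reindex[OF inj])
    fix c k assume "(\<Sum>i\<in>I. c (e i) *\<^sub>R e i) = 0" and k: "k \<in> I" and nz: "c (e k) \<noteq> 0"
    then have "(\<Sum>i\<in>I. c (e i) * blinfun_apply (e i) (f k)) = 0"
      by (metis (mono_tags, lifting) blinfun.sum_left blinfun.scaleR_left blinfun.zero_left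
          real_scaleR_def sum.cong)
    then have "(\<Sum>i\<in>I. if i = k then c (e i) else 0) = 0"
      using d(1) k by (subst (asm) sum.cong[OF refl, of _ _ "\<lambda>i. if i = k then c (e i) else 0"]) auto
    then show False using nz k assms(1) by simp
  qed
  moreover have "\<alpha> \<in> span (e ` I)" for \<alpha>
  proof -
    have "\<alpha> = (\<Sum>i\<in>I. blinfun_apply \<alpha> (f i) *\<^sub>R e i)"
    proof (rule blinfun_eqI)
      fix v
      show "blinfun_apply \<alpha> v = blinfun_apply (\<Sum>i\<in>I. blinfun_apply \<alpha> (f i) *\<^sub>R e i) v"
        by (subst d(2)[of v]) (simp add: blinfun.bilinear_simps blinfun.sum_left blinfun.sum_right mult.commute)
    qed
    then show ?thesis
      by (metis (no_types, lifting) imageI span_base span_scale span_sum)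
  qed
  ultimately show ?thesis using inj by (auto simp: basis_family_def)
qed

text \<open>The difference between \<open>v\<close> and its expansion is annihilated by every
  \<open>e k\<close>, hence is zero by separation.\<close>

lemma dual_frameI:
  assumes "finite I"
    and dual: "\<And>i j. i \<in> I \<Longrightarrow> j \<in> I \<Longrightarrow> blinfun_apply (e i) (f j) = (if i = j then 1 else 0)"
    and sep: "\<And>v. (\<And>i. i \<in> I \<Longrightarrow> blinfun_apply (e i) v = 0) \<Longrightarrow> v = 0"
  shows "dual_frame I e f"
proof -
  have "v = (\<Sum>i\<in>I. blinfun_apply (e i) v *\<^sub>R f i)" (is "v = ?s") for v
  proof -
    have "v - ?s = 0"
    proof (rule sep)
      fix k assume k: "k \<in> I"
      have "blinfun_apply (e k) ?s = (\<Sum>i\<in>I. if i = k then blinfun_apply (e i) v else 0)"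
        using dual k by (auto simp: blinfun.bilinear_simps blinfun.sum_right intro!: sum.cong)
      then show "blinfun_apply (e k) (v - ?s) = 0"
        using k assms(1) by (simp add: blinfun.bilinear_simps)
    qed
    then show ?thesis by simp
  qed
  then show ?thesis using dual by (auto simp: dual_frame_def)
qed

text \<open>The inner product with \<open>v\<close> is a covector in the span of the
  \<open>e i\<close>, so it vanishes at \<open>v\<close> itself, where its value is the squared
  norm.\<close>

lemma basis_covectors_separate:
  fixes e :: "'i \<Rightarrow> 'a::real_inner \<Rightarrow>\<^sub>L real"
  assumes "basis_family I e UNIV" "\<And>i. i \<in> I \<Longrightarrow> blinfun_apply (e i) v = 0"
  shows "v = 0"
proof -
  have "blinfun_inner_right v \<in> span (e ` I)"
    using assms(1) by (simp add: basis_family_def)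
  then have "blinfun_apply (blinfun_inner_right v) v = 0"
    by (induction rule: span_induct_alt) (use assms(2) in \<open>auto simp: blinfun.bilinear_simps\<close>)
  then show ?thesis by simp
qed

lemma smooth_on_det:
  fixes A :: "'a::real_normed_vector \<Rightarrow> real^'n^'n"
  assumes "open S" "\<And>r s. smooth_on S (\<lambda>x. A x $ r $ s)"
  shows "smooth_on S (\<lambda>x. det (A x))"
  unfolding det_def by (intro smooth_intros assms)

text \<open>The dual vectors are the columns of the inverse of the coefficient matrix. Cramer's rule
  writes their entries as quotients of determinants, which shows that they depend smoothly on the
  point.\<close>

lemma smooth_dual_frame_exists:
  fixes \<omega> :: "nat \<Rightarrow> (real^'n) one_form"
  assumes "open U" "coframe_on U I \<omega>" "card I = CARD('n)"
  obtains E where "\<And>i. smooth_on U (E i)"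
    "\<And>x. x \<in> U \<Longrightarrow> dual_frame I (\<lambda>i. \<omega> i x) (\<lambda>i. E i x)"
proof -
  have "finite I" using assms(3) by (metis card.infinite zero_less_card_finite less_numeral_extra(3))
  then obtain h :: "'n \<Rightarrow> nat" where h: "bij_betw h UNIV I"
    using finite_same_card_bij[of "UNIV :: 'n set" I] assms(3) by auto
  define A where "A x = (\<chi> r s. blinfun_apply (\<omega> (h r) x) (axis s 1))" for x
  have mult: "(A x *v v) $ r = blinfun_apply (\<omega> (h r) x) v" for x v r
    by (subst (2) basis_expansion[symmetric])
      (simp add: A_def matrix_vector_mult_def scalar_mult_eq_scaleR blinfun.bilinear_simps
        blinfun.sum_right mult.commute)
  have ker: "v = 0" if "x \<in> U" "A x *v v = 0" for x v
  proof (rule basis_covectors_separate)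
    show "basis_family I (\<lambda>i. \<omega> i x) UNIV"
      using assms(2) that(1) by (simp add: coframe_on_def)
    show "blinfun_apply (\<omega> i x) v = 0" if "i \<in> I" for i
      using h that mult[of x v] \<open>A x *v v = 0\<close> by (auto simp: bij_betw_def image_iff)
  qed
  have det: "det (A x) \<noteq> 0" if "x \<in> U" for x
    using ker[OF that] matrix_left_invertible_ker[of "A x"]
    by (simp add: invertible_det_nz[symmetric] invertible_left_inverse)
  \<comment> \<open>Right-hand side of the linear system for the \<open>k\<close>-th dual vector:
    the unit vector in the row that carries \<open>\<omega> k\<close>. For \<open>k\<close> outside
    \<open>I\<close> it is some constant vector, which keeps \<open>E k\<close> smooth for every
    \<open>k\<close>.\<close>
  define b where "b k = (axis (inv_into UNIV h k) 1 :: real^'n)" for k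
  define E where "E k x = (\<Sum>j\<in>UNIV. (det (\<chi> r s. if s = j then b k $ r else A x $ r $ s) / det (A x)) *\<^sub>R
    (axis j 1 :: real^'n))" for k x
  have A: "smooth_on U (\<lambda>x. A x $ r $ s)" for r s
    unfolding A_def vec_lambda_beta
    using assms(2) h by (intro smooth_intros assms(1)) (auto simp: coframe_on_def bij_betw_def)
  then have "smooth_on U (\<lambda>x. (\<chi> r s. if s = j then b k $ r else A x $ r $ s) $ r $ s)" for j k r s
    by (cases "s = j") (auto intro!: smooth_intros assms(1))
  with A have "smooth_on U (\<lambda>x. E k x)" for k
    unfolding E_def by (intro smooth_intros smooth_on_det assms(1) det)
  moreover have "dual_frame I (\<lambda>i. \<omega> i x) (\<lambda>i. E i x)" if x: "x \<in> U" for x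
  proof -
    have "E k x = (\<chi> j. det (\<chi> r s. if s = j then b k $ r else A x $ r $ s) / det (A x))" for k
      using basis_expansion[of "\<chi> j. det (\<chi> r s. if s = j then b k $ r else A x $ r $ s) / det (A x)"]
      by (simp add: E_def scalar_mult_eq_scaleR)
    then have "A x *v E k x = b k" for k
      using cramer[OF det[OF x], of "E k x" "b k"] by simp
    then have "blinfun_apply (\<omega> (h r) x) (E k x) = b k $ r" for r k
      using mult[of x "E k x" r] by simp
    then have dual: "blinfun_apply (\<omega> i x) (E k x) = (if i = k then 1 else 0)"
      if "i \<in> I" "k \<in> I" for i k
      using h that
      by (auto simp: b_def axis_def bij_betw_def inv_into_f_f f_inv_into_f image_iff)
    show ?thesis
    proof (rule dual_frameI[OF \<open>finite I\<close> dual])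
      show "v = 0" if "\<And>i. i \<in> I \<Longrightarrow> blinfun_apply (\<omega> i x) v = 0" for v
        using assms(2) x that by (intro basis_covectors_separate[of I "\<lambda>i. \<omega> i x"]) (auto simp: coframe_on_def)
    qed
  qed
  ultimately show ?thesis using that by blast
qed

text \<open>Expanding both arguments gives a double sum over \<open>I\<close>. Skewness kills the
  diagonal and folds the part below it onto the part above.\<close>

lemma alternating_expansion:
  fixes e :: "nat \<Rightarrow> 'a::real_normed_vector \<Rightarrow>\<^sub>L real"
  assumes "finite I" "dual_frame I e f"
    and lin: "\<And>u. linear (\<Omega> u)" "\<And>v. linear (\<lambda>u. \<Omega> u v)"
    and skew: "\<And>u v. \<Omega> v u = - \<Omega> u v"
  shows "\<Omega> u v = (\<Sum>(i, j) | i \<in> I \<and> j \<in> I \<and> i < j. \<Omega> (f i) (f j) * wedge (e i) (e j) u v)"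
proof -
  define g where "g i j = blinfun_apply (e i) u * blinfun_apply (e j) v * \<Omega> (f i) (f j)" for i j
  have "\<Omega> u v = (\<Sum>j\<in>I. \<Sum>i\<in>I. g i j)"
    by (subst dual_frameD(2)[OF assms(2), of u], subst dual_frameD(2)[OF assms(2), of v])
      (simp add: linear_sum[OF lin(1)] linear_sum[OF lin(2)] linear_scale[OF lin(1)]
        linear_scale[OF lin(2)] sum_distrib_left g_def
        mult.assoc mult.left_commute)
  also have "\<dots> = (\<Sum>i\<in>I. \<Sum>j\<in>I. g i j)"
    by (rule sum.swap)
  also have "\<dots> = (\<Sum>(i, j)\<in>I \<times> I. g i j)"
    by (simp add: sum.cartesian_product)
  also have "\<dots> = (\<Sum>(i, j)\<in>{(i, j). i \<in> I \<and> j \<in> I \<and> i < j} \<union>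
      {(i, j). i \<in> I \<and> j \<in> I \<and> j < i}. g i j)"
  proof (rule sum.mono_neutral_right)
    have "g i i = 0" for i using skew[of "f i" "f i"] by (simp add: g_def)
    then show "\<forall>p\<in>I \<times> I - ({(i, j). i \<in> I \<and> j \<in> I \<and> i < j} \<union>
        {(i, j). i \<in> I \<and> j \<in> I \<and> j < i}). (case p of (i, j) \<Rightarrow> g i j) = 0"
      by (auto; metis linorder_neqE_nat)
  qed (use assms(1) in auto)
  also have "\<dots> = (\<Sum>(i, j) | i \<in> I \<and> j \<in> I \<and> i < j. g i j) +
      (\<Sum>(i, j) | i \<in> I \<and> j \<in> I \<and> j < i. g i j)"
    by (rule sum.union_disjoint)
      (use assms(1) in \<open>auto intro: finite_subset[of _ "I \<times> I"]\<close>)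
  also have "(\<Sum>(i, j) | i \<in> I \<and> j \<in> I \<and> j < i. g i j) = (\<Sum>(i, j) | i \<in> I \<and> j \<in> I \<and> i < j. g j i)"
    by (rule sum.reindex_bij_witness[of _ prod.swap prod.swap]) auto
  finally show ?thesis
    by (simp add: sum.distrib[symmetric] split_def)
      (auto intro!: sum.cong simp: g_def wedge_def skew[of "f (fst _)"] algebra_simps)
qed

lemma wedge_dual_frame:
  assumes "dual_frame I e f" "i \<in> I" "j \<in> I" "k \<in> I" "l \<in> I"
  shows "wedge (e i) (e j) (f k) (f l) =
    (if i = k then 1 else 0) * (if j = l then 1 else 0) -
    (if i = l then 1 else 0) * (if j = k then 1 else 0)"
  using assms by (simp add: wedge_def dual_frameD(1))

lemma ext_d_linear:
  assumes "\<alpha> differentiable (at x)"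
  shows "linear (ext_d \<alpha> x u)" "linear (\<lambda>u. ext_d \<alpha> x u v)"
  using ext_d_bilinear[OF assms] by (auto intro: linearI)

section \<open>Coefficients of 2-forms in a coframe indexed by \<open>I9\<close>\<close>

lemma finite_I9: "finite I9"
  by (simp add: I9_def)

lemma sum_I9_pairs:
  fixes g :: "nat \<Rightarrow> nat \<Rightarrow> real"
  shows "(\<Sum>(i, j) | i \<in> I9 \<and> j \<in> I9 \<and> i < j. g i j) =
    g 0 1 + g 0 2 + g 0 3 + g 0 4 + g 0 5 + g 0 6 + g 0 8 + g 0 12 + g 1 2 + g 1 3 + g 1 4
    + g 1 5 + g 1 6 + g 1 8 + g 1 12 + g 2 3 + g 2 4 + g 2 5 + g 2 6 + g 2 8 + g 2 12 + g
    3 4 + g 3 5 + g 3 6 + g 3 8 + g 3 12 + g 4 5 + g 4 6 + g 4 8 + g 4 12 + g 5 6 + g 5 8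
    + g 5 12 + g 6 8 + g 6 12 + g 8 12"
proof -
  have "{(i, j). i \<in> I9 \<and> j \<in> I9 \<and> i < j} = {q \<in> I9 \<times> I9. fst q < snd q}"
    by auto
  then have "(\<Sum>(i, j) | i \<in> I9 \<and> j \<in> I9 \<and> i < j. g i j) =
      (\<Sum>(i, j)\<in>I9 \<times> I9. if i < j then g i j else 0)"
    by (simp add: sum.inter_filter finite_I9 split_def)
  also have "\<dots> = (\<Sum>i\<in>I9. \<Sum>j\<in>I9. if i < j then g i j else 0)"
    by (simp add: sum.cartesian_product)
  finally show ?thesis by (simp add: I9_def add.assoc)
qed

text \<open>The coefficients of a 2-form in the basis of wedge products are its values on pairs of
  dual vectors. This replaces the existentially quantified coefficients by a single
  equation.\<close>

lemma zero_coeff_01_iff: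
  fixes \<theta> :: "nat \<Rightarrow> pt9 one_form"
  assumes "\<And>p. p \<in> S \<Longrightarrow> dual_frame I9 (\<lambda>i. \<theta> i p) (\<lambda>i. f i p)"
    and "\<And>p. p \<in> S \<Longrightarrow> \<theta> 5 differentiable (at p)"
  shows "zero_coeff_01 S \<theta> (ext_d (\<theta> 5)) \<longleftrightarrow> (\<forall>p\<in>S. ext_d (\<theta> 5) p (f 0 p) (f 1 p) = 0)"
proof
  assume z: "zero_coeff_01 S \<theta> (ext_d (\<theta> 5))"
  show "\<forall>p\<in>S. ext_d (\<theta> 5) p (f 0 p) (f 1 p) = 0"
  proof
    fix p assume p: "p \<in> S"
    obtain k :: "nat \<Rightarrow> nat \<Rightarrow> real" where k: "k 0 1 = 0"
      "\<And>u v. ext_d (\<theta> 5) p u v =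
        (\<Sum>(i, j) | i \<in> I9 \<and> j \<in> I9 \<and> i < j. k i j * wedge (\<theta> i p) (\<theta> j p) u v)"
      using z p unfolding zero_coeff_01_def by blast
    have "k i j * wedge (\<theta> i p) (\<theta> j p) (f 0 p) (f 1 p) = 0" if "i \<in> I9" "j \<in> I9" "i < j" for i j
    proof -
      have "0 \<in> I9" "1 \<in> I9" by (simp_all add: I9_def)
      from wedge_dual_frame[OF assms(1)[OF p] that(1,2) this] show ?thesis
        using that(3) k(1) by auto
    qed
    then show "ext_d (\<theta> 5) p (f 0 p) (f 1 p) = 0"
      unfolding k(2) by (intro sum.neutral) auto
  qed
next
  assume z: "\<forall>p\<in>S. ext_d (\<theta> 5) p (f 0 p) (f 1 p) = 0"
  show "zero_coeff_01 S \<theta> (ext_d (\<theta> 5))"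
    unfolding zero_coeff_01_def
  proof
    fix p assume p: "p \<in> S"
    show "\<exists>k. k 0 1 = 0 \<and> (\<forall>u v. ext_d (\<theta> 5) p u v =
        (\<Sum>(i, j) | i \<in> I9 \<and> j \<in> I9 \<and> i < j. k i j * wedge (\<theta> i p) (\<theta> j p) u v))"
    proof (intro exI[of _ "\<lambda>i j. ext_d (\<theta> 5) p (f i p) (f j p)"] conjI allI)
      show "ext_d (\<theta> 5) p (f 0 p) (f 1 p) = 0" using z p by blast
    next
      fix u v
      show "ext_d (\<theta> 5) p u v = (\<Sum>(i, j) | i \<in> I9 \<and> j \<in> I9 \<and> i < j.
          ext_d (\<theta> 5) p (f i p) (f j p) * wedge (\<theta> i p) (\<theta> j p) u v)"
        by (rule alternating_expansion[OF finite_I9 assms(1)[OF p]])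
          (rule ext_d_linear[OF assms(2)[OF p]] ext_d_skew)+
    qed
  qed
qed

section \<open>Uniqueness\<close>

text \<open>The torsion functions of the two coframes are unrelated, so the equations are evaluated
  only on pairs of dual vectors where the torsion terms drop out or are multiplied by a component
  already known to vanish. \<open>\<theta>\<^sup>1\<^sup>2\<close> occurs only in a product with
  \<open>\<theta>\<^sup>0\<close>, which is why its \<open>\<theta>\<^sup>0\<close> component stays
  free.\<close>

lemma structure_equations_determine:
  fixes \<theta> \<theta>' :: "nat \<Rightarrow> pt9 one_form"
  assumes "structure_equations S \<theta> T" "structure_equations S \<theta>' T'" "p \<in> S"
    and eq: "\<And>i. i \<in> {0..4} \<Longrightarrow> \<theta>' i p = \<theta> i p"
      "\<And>i. i \<in> {0..4} \<Longrightarrow> ext_d (\<theta>' i) p = ext_d (\<theta> i) p"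
    and dual: "dual_frame I9 (\<lambda>i. \<theta> i p) f"
  shows "\<theta>' 5 p = \<theta> 5 p" "\<theta>' 6 p = \<theta> 6 p" "\<theta>' 8 p = \<theta> 8 p"
    "\<theta>' 12 p = \<theta> 12 p + blinfun_apply (\<theta>' 12 p) (f 0) *\<^sub>R \<theta> 0 p"
proof -
  define A where "A i j = blinfun_apply (\<theta>' i p) (f j)" for i j
  have d: "blinfun_apply (\<theta> i p) (f j) = (if i = j then 1 else 0)" if "i \<in> I9" "j \<in> I9" for i j
    using dual_frameD(1)[OF dual that] .
  have A: "blinfun_apply (\<theta>' 5 p) (f j) = A 5 j" "blinfun_apply (\<theta>' 6 p) (f j) = A 6 j"
    "blinfun_apply (\<theta>' 8 p) (f j) = A 8 j" "blinfun_apply (\<theta>' 12 p) (f j) = A 12 j" for j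
    by (simp_all add: A_def)
  note eqs = assms(1,2)[unfolded structure_equations_def Let_def, rule_format, OF assms(3)]
  note s = wedge_def A d I9_def eq(1)
  have E0: "- 6 * wedge (\<theta> 0 p) (\<theta>' 5 p) u v = - 6 * wedge (\<theta> 0 p) (\<theta> 5 p) u v" for u v
    using eqs[of u v] eq by simp
  have E1: "- 3 * wedge (\<theta> 1 p) (\<theta>' 5 p) u v - 3 * wedge (\<theta> 1 p) (\<theta>' 8 p) u v
      + T' 1 0 2 p * wedge (\<theta> 0 p) (\<theta> 2 p) u v + T' 1 0 3 p * wedge (\<theta> 0 p) (\<theta> 3 p) u v
      + T' 1 0 4 p * wedge (\<theta> 0 p) (\<theta> 4 p) u v + T' 1 0 6 p * wedge (\<theta> 0 p) (\<theta>' 6 p) u v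
      + T' 1 2 4 p * wedge (\<theta> 2 p) (\<theta> 4 p) u v =
      - 3 * wedge (\<theta> 1 p) (\<theta> 5 p) u v - 3 * wedge (\<theta> 1 p) (\<theta> 8 p) u v
      + T 1 0 2 p * wedge (\<theta> 0 p) (\<theta> 2 p) u v + T 1 0 3 p * wedge (\<theta> 0 p) (\<theta> 3 p) u v
      + T 1 0 4 p * wedge (\<theta> 0 p) (\<theta> 4 p) u v + T 1 0 6 p * wedge (\<theta> 0 p) (\<theta> 6 p) u v
      + T 1 2 4 p * wedge (\<theta> 2 p) (\<theta> 4 p) u v" for u v
    using eqs[of u v] eq by simp
  have E2: "wedge (\<theta> 1 p) (\<theta>' 6 p) u v - 3 * wedge (\<theta> 2 p) (\<theta>' 5 p) u v
      - wedge (\<theta> 2 p) (\<theta>' 8 p) u v + T' 2 0 3 p * wedge (\<theta> 0 p) (\<theta> 3 p) u v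
      - T' 2 0 4 p * wedge (\<theta> 0 p) (\<theta> 4 p) u v + T' 2 3 4 p * wedge (\<theta> 3 p) (\<theta> 4 p) u v =
      wedge (\<theta> 1 p) (\<theta> 6 p) u v - 3 * wedge (\<theta> 2 p) (\<theta> 5 p) u v
      - wedge (\<theta> 2 p) (\<theta> 8 p) u v + T 2 0 3 p * wedge (\<theta> 0 p) (\<theta> 3 p) u v
      - T 2 0 4 p * wedge (\<theta> 0 p) (\<theta> 4 p) u v + T 2 3 4 p * wedge (\<theta> 3 p) (\<theta> 4 p) u v" for u v
    using eqs[of u v] eq by simp
  have E4: "6 * wedge (\<theta> 0 p) (\<theta>' 12 p) u v + 3 * wedge (\<theta> 3 p) (\<theta>' 6 p) u v
      - 3 * wedge (\<theta> 4 p) (\<theta>' 5 p) u v + 3 * wedge (\<theta> 4 p) (\<theta>' 8 p) u v =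
      6 * wedge (\<theta> 0 p) (\<theta> 12 p) u v + 3 * wedge (\<theta> 3 p) (\<theta> 6 p) u v
      - 3 * wedge (\<theta> 4 p) (\<theta> 5 p) u v + 3 * wedge (\<theta> 4 p) (\<theta> 8 p) u v" for u v
    using eqs[of u v] eq by simp
  have a5: "A 5 k = (if k = 5 then 1 else 0)" if "k \<in> I9" "k \<noteq> 0" for k
    using E0[of "f 0" "f k"] that by (auto simp: s)
  have a58: "A 5 k + A 8 k = (if k = 5 \<or> k = 8 then 1 else 0)" if "k \<in> I9" "k \<noteq> 0" "k \<noteq> 1" for k
    using E1[of "f 1" "f k"] that by (auto simp: s)
  have a6: "A 6 k = (if k = 6 then 1 else 0)" if "k \<in> I9" "k \<noteq> 0" "k \<noteq> 3" "k \<noteq> 4" for k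
    using E4[of "f 3" "f k"] that by (auto simp: s)
  have a6_4: "A 6 4 = A 8 3 - A 5 3"
    using E4[of "f 3" "f 4"] by (simp add: s)
  have a8_1: "A 8 1 = A 5 1"
    using E4[of "f 4" "f 1"] by (simp add: s)
  have a6_3: "A 6 3 = 0"
    using E2[of "f 1" "f 3"] by (simp add: s)
  have a6_0: "A 6 0 = 0"
    using E2[of "f 0" "f 1"] by (simp add: s)
  \<comment> \<open>The equations for \<open>d\<theta>\<^sup>2\<close> and
    \<open>d\<theta>\<^sup>1\<close> yield two independent relations between \<open>A 5 0\<close>
    and \<open>A 8 0\<close>, so both vanish. In the second one the torsion term at
    \<open>\<theta>\<^sup>0 \<and> \<theta>\<^sup>6\<close> drops out because
    \<open>A 6 1 = 0\<close>.\<close>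
  have a0: "3 * A 5 0 + A 8 0 = 0"
    using E2[of "f 0" "f 2"] by (simp add: s)
  have "A 6 1 = 0" using a6[of 1] by (simp add: I9_def)
  then have a0': "A 5 0 + A 8 0 = 0"
    using E1[of "f 0" "f 1"] by (simp add: s)
  have r5: "A 5 k = (if k = 5 then 1 else 0)" if "k \<in> I9" for k
    using a5[OF that] a0 a0' by (cases "k = 0") auto
  have r8: "A 8 k = (if k = 8 then 1 else 0)" if "k \<in> I9" for k
    using a58[OF that] a8_1 a5[of 1] a0 a0' r5[OF that] by (cases "k = 0"; cases "k = 1") (auto simp: I9_def)
  have r6: "A 6 k = (if k = 6 then 1 else 0)" if "k \<in> I9" for k
    using a6[OF that] a6_0 a6_3 a6_4 r5[of 3] r8[of 3]
    by (cases "k = 0"; cases "k = 3"; cases "k = 4") (auto simp: I9_def)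
  have r12: "A 12 k = (if k = 12 then 1 else 0)" if "k \<in> I9" "k \<noteq> 0" for k
    using E4[of "f 0" "f k"] that r5[of 0] r6[of 0] r8[of 0] by (auto simp: s)
  have ext: "\<alpha> = \<beta>" if "\<And>k. k \<in> I9 \<Longrightarrow> blinfun_apply \<alpha> (f k) = blinfun_apply \<beta> (f k)"
    for \<alpha> \<beta> :: "pt9 \<Rightarrow>\<^sub>L real"
  proof (rule blinfun_eqI)
    fix v
    show "blinfun_apply \<alpha> v = blinfun_apply \<beta> v"
      by (subst (1 2) dual_frameD(2)[OF dual, of v])
        (simp add: blinfun.sum_right blinfun.scaleR_right that)
  qed
  have mem: "5 \<in> I9" "6 \<in> I9" "8 \<in> I9" "12 \<in> I9" "0 \<in> I9" by (simp_all add: I9_def)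
  show "\<theta>' 5 p = \<theta> 5 p" "\<theta>' 6 p = \<theta> 6 p" "\<theta>' 8 p = \<theta> 8 p"
    by (rule ext; simp add: A d mem r5 r6 r8; fail)+
  show "\<theta>' 12 p = \<theta> 12 p + blinfun_apply (\<theta>' 12 p) (f 0) *\<^sub>R \<theta> 0 p"
  proof (rule ext)
    fix k assume "k \<in> I9"
    then show "blinfun_apply (\<theta>' 12 p) (f k) =
        blinfun_apply (\<theta> 12 p + blinfun_apply (\<theta>' 12 p) (f 0) *\<^sub>R \<theta> 0 p) (f k)"
      using r12[of k] by (cases "k = 0") (simp_all add: A d mem blinfun.bilinear_simps)
  qed
qed

text \<open>The coframes can differ only by a term \<open>m \<theta>\<^sup>0\<close> in index 12.
  Such a term changes the dual vector \<open>f 0\<close> to \<open>f 0 - m f 12\<close> and leaves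
  \<open>f 1\<close> alone, so the two normalizations together say that \<open>m\<close> times the
  value of \<open>d\<theta>\<^sup>5\<close> on \<open>f 12\<close>, \<open>f 1\<close> is
  zero.\<close>

lemma normalized_forms_unique:
  fixes \<theta> \<theta>' :: "nat \<Rightarrow> pt9 one_form"
  assumes "open S" "structure_equations S \<theta> T" "structure_equations S \<theta>' T'"
    and eq: "\<And>i p. i \<in> {0..4} \<Longrightarrow> p \<in> S \<Longrightarrow> \<theta>' i p = \<theta> i p"
    and diff: "\<And>i p. i \<in> I9 \<Longrightarrow> p \<in> S \<Longrightarrow> \<theta> i differentiable (at p)"
    and dual: "\<And>p. p \<in> S \<Longrightarrow> dual_frame I9 (\<lambda>i. \<theta> i p) (\<lambda>i. f i p)"
    and norm: "\<And>p. p \<in> S \<Longrightarrow> ext_d (\<theta> 5) p (f 12 p) (f 1 p) \<noteq> 0"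
    and "zero_coeff_01 S \<theta> (ext_d (\<theta> 5))" "zero_coeff_01 S \<theta>' (ext_d (\<theta>' 5))"
    and "i \<in> I9" "p \<in> S"
  shows "\<theta>' i p = \<theta> i p"
proof -
  have mem: "{0..4} \<subseteq> I9" "5 \<in> I9" "12 \<in> I9" "0 \<in> I9" "1 \<in> I9" by (auto simp: I9_def)
  have "ext_d (\<theta>' i) q = ext_d (\<theta> i) q" if "i \<in> {0..4}" "q \<in> S" for i q
    by (rule ext_d_cong_open[OF assms(1) that(2) eq[OF that(1), symmetric] diff[OF _ that(2)]])
      (use that(1) mem(1) in blast)+
  note det = structure_equations_determine[OF assms(2,3) _ eq this dual]
  have e5: "ext_d (\<theta>' 5) p = ext_d (\<theta> 5) p"
    by (rule ext_d_cong_open[OF assms(1) \<open>p \<in> S\<close>]) (use det(1) diff mem(2) \<open>p \<in> S\<close> in auto)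
  define m where "m = blinfun_apply (\<theta>' 12 p) (f 0 p)"
  have t12: "\<theta>' 12 p = \<theta> 12 p + m *\<^sub>R \<theta> 0 p"
    unfolding m_def by (rule det(4)) (use \<open>p \<in> S\<close> in auto)
  have others: "\<theta>' i p = \<theta> i p" if "i \<in> I9" "i \<noteq> 12" for i
    using that eq[OF _ \<open>p \<in> S\<close>, of i] det(1-3)[of p] \<open>p \<in> S\<close> by (auto simp: I9_def)
  have d: "blinfun_apply (\<theta> i p) (f j p) = (if i = j then 1 else 0)" if "i \<in> I9" "j \<in> I9" for i j
    using dual_frameD(1)[OF dual[OF \<open>p \<in> S\<close>] that] .
  define g where "g = f 0 p - m *\<^sub>R f 12 p"
  have g: "blinfun_apply (\<theta>' i p) g = (if i = 0 then 1 else 0)" if "i \<in> I9" for i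
    using that others[OF that] mem
    by (cases "i = 12") (auto simp: g_def t12 d blinfun.bilinear_simps)
  have f1: "blinfun_apply (\<theta>' i p) (f 1 p) = (if i = 1 then 1 else 0)" if "i \<in> I9" for i
    using that others[OF that] mem by (cases "i = 12") (auto simp: t12 d blinfun.bilinear_simps)
  obtain k :: "nat \<Rightarrow> nat \<Rightarrow> real" where k: "k 0 1 = 0"
    "\<And>u v. ext_d (\<theta>' 5) p u v =
      (\<Sum>(i, j) | i \<in> I9 \<and> j \<in> I9 \<and> i < j. k i j * wedge (\<theta>' i p) (\<theta>' j p) u v)"
    using assms(9) \<open>p \<in> S\<close> unfolding zero_coeff_01_def by blast
  have "k i j * wedge (\<theta>' i p) (\<theta>' j p) g (f 1 p) = 0" if "i \<in> I9" "j \<in> I9" "i < j" for i j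
    using that k(1) g f1 by (auto simp: wedge_def)
  then have "ext_d (\<theta>' 5) p g (f 1 p) = 0"
    unfolding k(2) by (intro sum.neutral) auto
  moreover have "ext_d (\<theta> 5) p (f 0 p) (f 1 p) = 0"
    using zero_coeff_01_iff[of S \<theta> f] assms(8) dual diff mem \<open>p \<in> S\<close> by blast
  moreover have "ext_d (\<theta> 5) p (f 0 p + (- m) *\<^sub>R f 12 p) (f 1 p) =
      ext_d (\<theta> 5) p (f 0 p) (f 1 p) + (- m) * ext_d (\<theta> 5) p (f 12 p) (f 1 p)"
    by (simp only: ext_d_bilinear[OF diff[OF mem(2) \<open>p \<in> S\<close>]])
  ultimately have "m * ext_d (\<theta> 5) p (f 12 p) (f 1 p) = 0"
    unfolding e5 g_def by simp
  then have "m = 0" using norm \<open>p \<in> S\<close> by simp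
  then show ?thesis using others t12 \<open>i \<in> I9\<close> by (cases "i = 12") auto
qed

section \<open>The base frame\<close>

lemma open_G9:
  assumes "open U"
  shows "open (G9 U)"
proof -
  have "G9 U = fst -` U \<inter> {p. fst (snd p) * fst (snd (snd (snd p))) \<noteq> 0}"
    by (auto simp: G9_def)
  moreover have "open (fst -` U :: pt9 set)"
    using assms by (simp add: open_vimage_fst)
  moreover have "open {p :: pt9. fst (snd p) * fst (snd (snd (snd p))) \<noteq> 0}"
    by (intro open_Collect_neq continuous_intros)
  ultimately show ?thesis by auto
qed

lemma sum_atMost_4: "(\<Sum>m\<le>4. f m) = f 0 + f 1 + f 2 + f 3 + f (4::nat)"
  by (simp add: eval_nat_numeral)

lemma le_4_cases:
  fixes i :: nat
  assumes "i \<le> 4"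
  obtains "i = 0" | "i = 1" | "i = 2" | "i = 3" | "i = 4"
  using assms by (auto simp: le_Suc_eq eval_nat_numeral)

abbreviation "fibre_\<delta> \<equiv> (\<lambda>p :: pt9. fst (snd p))"
abbreviation "fibre_s4 \<equiv> (\<lambda>p :: pt9. fst (snd (snd p)))"
abbreviation "fibre_s5 \<equiv> (\<lambda>p :: pt9. fst (snd (snd (snd p))))"
abbreviation "fibre_s7 \<equiv> (\<lambda>p :: pt9. snd (snd (snd (snd p))))"

lemma bounded_linear_fibre:
  "bounded_linear fibre_\<delta>" "bounded_linear fibre_s4" "bounded_linear fibre_s5"
  "bounded_linear fibre_s7"
  by (intro bounded_linear_intros)+

lemma smooth_on_fibre [smooth_intros]:
  assumes "open S"
  shows "smooth_on S fibre_\<delta>" "smooth_on S fibre_s4" "smooth_on S fibre_s5" "smooth_on S fibre_s7"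
  by (intro smooth_on_linear assms bounded_linear_fibre)+

lemma G9_nonzero: "p \<in> G9 U \<Longrightarrow> fibre_\<delta> p \<noteq> 0" "p \<in> G9 U \<Longrightarrow> fibre_s5 p \<noteq> 0"
  "p \<in> G9 U \<Longrightarrow> fst p \<in> U"
  by (auto simp: G9_def)

text \<open>The vertical vectors are chosen so that they act on the coefficients of \<open>\<theta>\<^sup>0, \<dots>, \<theta>\<^sup>4\<close> by
  almost constant matrices, see \<open>fibre_action\<close>: those with index \<open>5\<close> and \<open>8\<close> generate scalings, those with
  index \<open>6\<close> and \<open>12\<close> translate \<open>s\<^sub>7\<close> and \<open>s\<^sub>4\<close>.\<close>

definition fibre_form :: "nat \<Rightarrow> pt9 one_form" where
  "fibre_form k p =
     (let \<delta> = fibre_\<delta> p; s4 = fibre_s4 p; s5 = fibre_s5 p; s7 = fibre_s7 p;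
          d\<delta> = Blinfun fibre_\<delta>; ds4 = Blinfun fibre_s4; ds5 = Blinfun fibre_s5; ds7 = Blinfun fibre_s7
      in if k = 5 then (1 / (2 * \<delta>)) *\<^sub>R d\<delta>
         else if k = 6 then (s7 / (\<delta> * s5)) *\<^sub>R d\<delta> - (s7 / s5^2) *\<^sub>R ds5 - (1 / s5) *\<^sub>R ds7
         else if k = 8 then (1 / s5) *\<^sub>R ds5 - (1 / (2 * \<delta>)) *\<^sub>R d\<delta>
         else (1 / (6 * \<delta>^3)) *\<^sub>R ds4 + (s4 / (2 * \<delta>^3 * s5)) *\<^sub>R ds5 - (s4 / (2 * \<delta>^4)) *\<^sub>R d\<delta>)"

definition fibre_vector :: "nat \<Rightarrow> pt9 \<Rightarrow> pt9" where
  "fibre_vector k p =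
     (let \<delta> = fibre_\<delta> p; s4 = fibre_s4 p; s5 = fibre_s5 p; s7 = fibre_s7 p
      in if k = 5 then (0, 2 * \<delta>, 3 * s4, s5, s7)
         else if k = 6 then (0, 0, 0, 0, - s5)
         else if k = 8 then (0, 0, - 3 * s4, s5, - s7)
         else (0, 0, 6 * \<delta>^3, 0, 0))"

lemma fst_fibre_vector [simp]: "fst (fibre_vector k p) = 0"
  by (simp add: fibre_vector_def Let_def)

lemma fibre_form_apply:
  "blinfun_apply (fibre_form 5 p) v = fibre_\<delta> v / (2 * fibre_\<delta> p)"
  "blinfun_apply (fibre_form 6 p) v = fibre_s7 p / (fibre_\<delta> p * fibre_s5 p) * fibre_\<delta> v
     - fibre_s7 p / (fibre_s5 p)^2 * fibre_s5 v - fibre_s7 v / fibre_s5 p"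
  "blinfun_apply (fibre_form 8 p) v = fibre_s5 v / fibre_s5 p - fibre_\<delta> v / (2 * fibre_\<delta> p)"
  "blinfun_apply (fibre_form 12 p) v = fibre_s4 v / (6 * (fibre_\<delta> p)^3)
     + fibre_s4 p / (2 * (fibre_\<delta> p)^3 * fibre_s5 p) * fibre_s5 v
     - fibre_s4 p / (2 * (fibre_\<delta> p)^4) * fibre_\<delta> v"
  by (simp_all add: fibre_form_def Let_def blinfun.bilinear_simps bounded_linear_Blinfun_apply
      bounded_linear_fibre)

lemma smooth_on_fibre_form:
  assumes "open U"
  shows "smooth_on (G9 U) (fibre_form k)"
proof -
  note [smooth_intros] = open_G9[OF assms]
  show ?thesis
    unfolding fibre_form_def Let_def
    by (cases "k = 5"; cases "k = 6"; cases "k = 8"; simp)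
      (intro smooth_intros; auto dest: G9_nonzero)+
qed

lemma smooth_on_fibre_vector:
  assumes "open U"
  shows "smooth_on (G9 U) (fibre_vector k)"
proof -
  note [smooth_intros] = open_G9[OF assms]
  show ?thesis
    unfolding fibre_vector_def Let_def
    by (cases "k = 5"; cases "k = 6"; cases "k = 8"; simp del: prod.collapse)
      (intro smooth_intros)+
qed

lemma fibre_dual:
  assumes "p \<in> G9 U" "k \<in> {5, 6, 8, 12}" "l \<in> {5, 6, 8, 12}"
  shows "blinfun_apply (fibre_form k p) (fibre_vector l p) = (if k = l then 1 else 0)"
  using assms G9_nonzero[OF assms(1)]
  by (auto simp: fibre_form_apply fibre_vector_def Let_def)
    (auto simp: field_simps eval_nat_numeral)

text \<open>Completeness in the fibre directions: if all four fibre forms vanish on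
  \<open>v\<close>, then \<open>snd v = 0\<close>.\<close>

lemma fibre_expansion:
  assumes "p \<in> G9 U"
  shows "(\<Sum>k\<in>{5, 6, 8, 12}. blinfun_apply (fibre_form k p) v *\<^sub>R fibre_vector k p) = (0, snd v)"
  using G9_nonzero[OF assms]
  by (simp add: fibre_form_apply fibre_vector_def Let_def prod_eq_iff)
    (simp add: field_simps eval_nat_numeral)

section \<open>Algebra of the structure group\<close>

text \<open>The matrix that expresses \<open>\<theta>\<^sup>i\<close> through the pulled back
  \<open>\<omega>\<^sup>m\<close>. It takes real arguments, so that computations with the structure
  group become identities of rational functions.\<close>

definition theta_coeff ::
  "real \<Rightarrow> real \<Rightarrow> real \<Rightarrow> real \<Rightarrow> real \<Rightarrow> real \<Rightarrow> real \<Rightarrow> real \<Rightarrow> nat \<Rightarrow> nat \<Rightarrow> real" where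
  "theta_coeff a b c J \<delta> s4 s5 s7 i m =
   [[- (\<delta>^3), 0, 0, 0, 0],
    [s5^3 * (3 * J * s5 * s7 - a * \<delta>) / \<delta>, s5^3, 0, 0, 0],
    [s5 * (b * \<delta>^2 - 2 * a * \<delta> * s5 * s7 + 3 * J * s5^2 * s7^2) / (2 * \<delta>),
     s5^2 * s7, - (\<delta> * s5), 0, 0],
    [(- c * \<delta>^3 + b * \<delta>^2 * s5 * s7 - a * \<delta> * s5^2 * s7^2 + J * s5^3 * s7^3) / (\<delta> * s5),
     s5 * s7^2, - (2 * \<delta> * s7), \<delta>^2 / s5, 0],
    [s4, s7^3, - (3 * \<delta> * s7^2 / s5), 3 * \<delta>^2 * s7 / s5^2, - (\<delta>^3 / s5^3)]] ! i ! m"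

text \<open>Column \<open>i\<close> holds the components, in the coframe \<open>\<omega>\<close>, of
  the vector dual to \<open>\<theta>\<^sup>i\<close>.\<close>

definition inv_theta_coeff ::
  "real \<Rightarrow> real \<Rightarrow> real \<Rightarrow> real \<Rightarrow> real \<Rightarrow> real \<Rightarrow> real \<Rightarrow> real \<Rightarrow> nat \<Rightarrow> nat \<Rightarrow> real" where
  "inv_theta_coeff a b c J \<delta> s4 s5 s7 m i =
   [[- 1 / \<delta>^3, 0, 0, 0, 0],
    [3 * J * s5 * s7 / \<delta>^4 - a / \<delta>^3, 1 / s5^3, 0, 0, 0],
    [- b / (2 * \<delta>^3) + 3 * J * s5^2 * s7^2 / (2 * \<delta>^5), s7 / (\<delta> * s5^2), - 1 / (\<delta> * s5), 0, 0],
    [- c / \<delta>^3 + J * s5^3 * s7^3 / \<delta>^6, s7^2 / (\<delta>^2 * s5), - 2 * s7 / \<delta>^2, s5 / \<delta>^2, 0],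
    [- s4 * s5^3 / \<delta>^6
       + 3 * J * s5^4 * s7^4 / (2 * \<delta>^7) - a * s5^3 * s7^3 / \<delta>^6
       + 3 * b * s5^2 * s7^2 / (2 * \<delta>^5) - 3 * c * s5 * s7 / \<delta>^4,
     s7^3 / \<delta>^3, - 3 * s5 * s7^2 / \<delta>^3, 3 * s5^2 * s7 / \<delta>^3, - (s5^3 / \<delta>^3)]] ! m ! i"

lemma inv_theta_coeff:
  assumes "\<delta> \<noteq> 0" "s5 \<noteq> 0" "m \<le> 4" "n \<le> 4"
  shows "(\<Sum>i\<le>4. inv_theta_coeff a b c J \<delta> s4 s5 s7 m i * theta_coeff a b c J \<delta> s4 s5 s7 i n) =
    (if m = n then 1 else 0)"
    "(\<Sum>i\<le>4. theta_coeff a b c J \<delta> s4 s5 s7 m i * inv_theta_coeff a b c J \<delta> s4 s5 s7 i n) =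
    (if m = n then 1 else 0)"
  using assms(1,2)
  by (rule_tac le_4_cases[OF assms(3)]; rule_tac le_4_cases[OF assms(4)];
      simp add: theta_coeff_def inv_theta_coeff_def sum_atMost_4;
      simp add: field_simps eval_nat_numeral; fail)+

text \<open>The total differential, kept linear in the increments so that motions along the base and
  along the fibre can be separated by setting increments to zero.\<close>

definition theta_coeff_deriv ::
  "real \<Rightarrow> real \<Rightarrow> real \<Rightarrow> real \<Rightarrow> real \<Rightarrow> real \<Rightarrow> real \<Rightarrow> real \<Rightarrow>
   real \<Rightarrow> real \<Rightarrow> real \<Rightarrow> real \<Rightarrow> real \<Rightarrow> real \<Rightarrow> real \<Rightarrow> real \<Rightarrow> nat \<Rightarrow> nat \<Rightarrow> real" where
  "theta_coeff_deriv a b c J \<delta> s4 s5 s7 da db dc dJ d\<delta> ds4 ds5 ds7 i m =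
   [[(- 3 * \<delta>^2) * d\<delta>, 0, 0, 0, 0],
    [(- 3 * J * s5^4 * s7 / \<delta>^2) * d\<delta> + (12 * J * s5^3 * s7 / \<delta> - 3 * a * s5^2) * ds5
       + (3 * J * s5^4 / \<delta>) * ds7 + (- (s5^3)) * da + (3 * s5^4 * s7 / \<delta>) * dJ,
     (3 * s5^2) * ds5, 0, 0, 0],
    [(b * s5 / 2 - 3 * J * s5^3 * s7^2 / (2 * \<delta>^2)) * d\<delta>
       + (\<delta> * b / 2 - 2 * a * s5 * s7 + 9 * J * s5^2 * s7^2 / (2 * \<delta>)) * ds5
       + (- a * s5^2 + 3 * J * s5^3 * s7 / \<delta>) * ds7 + (- (s5^2 * s7)) * da + (\<delta> * s5 / 2) * db
       + (3 * s5^3 * s7^2 / (2 * \<delta>)) * dJ,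
     (2 * s5 * s7) * ds5 + (s5^2) * ds7,
     (- s5) * d\<delta> + (- \<delta>) * ds5, 0, 0],
    [(- 2 * \<delta> * c / s5 + b * s7 - J * s5^2 * s7^3 / \<delta>^2) * d\<delta>
       + (\<delta>^2 * c / s5^2 - a * s7^2 + 2 * J * s5 * s7^3 / \<delta>) * ds5
       + (\<delta> * b - 2 * a * s5 * s7 + 3 * J * s5^2 * s7^2 / \<delta>) * ds7 + (- s5 * s7^2) * da
       + (\<delta> * s7) * db + (- (\<delta>^2 / s5)) * dc + (s5^2 * s7^3 / \<delta>) * dJ,
     (s7^2) * ds5 + (2 * s5 * s7) * ds7,
     (- 2 * s7) * d\<delta> + (- 2 * \<delta>) * ds7,
     (2 * \<delta> / s5) * d\<delta> + (- (\<delta>^2 / s5^2)) * ds5, 0],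
    [(1) * ds4,
     (3 * s7^2) * ds7,
     (- 3 * s7^2 / s5) * d\<delta> + (3 * \<delta> * s7^2 / s5^2) * ds5 + (- 6 * \<delta> * s7 / s5) * ds7,
     (6 * \<delta> * s7 / s5^2) * d\<delta> + (- 6 * \<delta>^2 * s7 / s5^3) * ds5 + (3 * \<delta>^2 / s5^2) * ds7,
     (- 3 * \<delta>^2 / s5^3) * d\<delta> + (3 * \<delta>^3 / s5^4) * ds5]] ! i ! m"

lemma theta_coeff_has_derivative:
  fixes x :: "'a::real_normed_vector"
  assumes "(a has_derivative da) (at x)" "(b has_derivative db) (at x)"
    "(c has_derivative dc) (at x)" "(J has_derivative dJ) (at x)"
    "(\<delta> has_derivative d\<delta>) (at x)" "(s4 has_derivative ds4) (at x)"
    "(s5 has_derivative ds5) (at x)" "(s7 has_derivative ds7) (at x)"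
    and nz: "\<delta> x \<noteq> 0" "s5 x \<noteq> 0" and "i \<le> 4" "m \<le> 4"
  shows "((\<lambda>x. theta_coeff (a x) (b x) (c x) (J x) (\<delta> x) (s4 x) (s5 x) (s7 x) i m) has_derivative
    (\<lambda>u. theta_coeff_deriv (a x) (b x) (c x) (J x) (\<delta> x) (s4 x) (s5 x) (s7 x)
       (da u) (db u) (dc u) (dJ u) (d\<delta> u) (ds4 u) (ds5 u) (ds7 u) i m)) (at x)"
proof -
  note d = derivative_eq_intros assms(1-8)
  show ?thesis
    by (rule le_4_cases[OF \<open>i \<le> 4\<close>]; rule le_4_cases[OF \<open>m \<le> 4\<close>];
        simp add: theta_coeff_def theta_coeff_deriv_def)
      ((rule d refl)+; (simp add: nz; fail)?; simp add: nz fun_eq_iff field_simps eval_nat_numeral; fail)+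
qed

text \<open>The infinitesimal action of the structure group: differentiating the matrix
  \<open>theta_coeff\<close> along \<open>fibre_vector k\<close> multiplies it on the left by this
  matrix. The entry in row 1 for \<open>k = 6\<close> becomes \<open>torsion 1 0 6\<close> up to
  sign.\<close>

definition fibre_action ::
  "real \<Rightarrow> real \<Rightarrow> real \<Rightarrow> real \<Rightarrow> real \<Rightarrow> real \<Rightarrow> real \<Rightarrow> nat \<Rightarrow> nat \<Rightarrow> nat \<Rightarrow> real" where
  "fibre_action a b c J \<delta> s5 s7 k i j =
     (if k = 5 then if i = j then (if i = 0 then 6 else 3) else 0
      else if k = 6 then
        (if i = 1 \<and> j = 0 then 3 * J * s5^5 / \<delta>^4
         else if i = 2 \<and> j = 1 then - 1
         else if i = 3 \<and> j = 2 then - 2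
         else if i = 4 \<and> j = 3 then - 3
         else if i = 4 \<and> j = 0 then
           3 * c / (\<delta> * s5) - 3 * b * s7 / \<delta>^2 + 3 * a * s5 * s7^2 / \<delta>^3 - 3 * J * s5^2 * s7^3 / \<delta>^4
         else 0)
      else if k = 8 then if i = j \<and> i \<noteq> 0 then 5 - 2 * real i else 0
      else if i = 4 \<and> j = 0 then - 6 else 0)"

text \<open>The increments are the components of the vertical vectors with index 5, 6, 8 and 12,
  with the base point held fixed.\<close>

lemma theta_coeff_deriv_fibre:
  assumes "\<delta> \<noteq> 0" "s5 \<noteq> 0" "i \<le> 4" "m \<le> 4"
  shows
    "theta_coeff_deriv a b c J \<delta> s4 s5 s7 0 0 0 0 (2 * \<delta>) (3 * s4) s5 s7 i m =
     (\<Sum>j\<le>4. fibre_action a b c J \<delta> s5 s7 5 i j * theta_coeff a b c J \<delta> s4 s5 s7 j m)" (is ?A)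
    "theta_coeff_deriv a b c J \<delta> s4 s5 s7 0 0 0 0 0 0 0 (- s5) i m =
     (\<Sum>j\<le>4. fibre_action a b c J \<delta> s5 s7 6 i j * theta_coeff a b c J \<delta> s4 s5 s7 j m)" (is ?B)
    "theta_coeff_deriv a b c J \<delta> s4 s5 s7 0 0 0 0 0 (- 3 * s4) s5 (- s7) i m =
     (\<Sum>j\<le>4. fibre_action a b c J \<delta> s5 s7 8 i j * theta_coeff a b c J \<delta> s4 s5 s7 j m)" (is ?C)
    "theta_coeff_deriv a b c J \<delta> s4 s5 s7 0 0 0 0 0 (6 * \<delta>^3) 0 0 i m =
     (\<Sum>j\<le>4. fibre_action a b c J \<delta> s5 s7 12 i j * theta_coeff a b c J \<delta> s4 s5 s7 j m)" (is ?D)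
proof -
  note nz = assms(1,2)
  note cases = le_4_cases[OF \<open>i \<le> 4\<close>] le_4_cases[OF \<open>m \<le> 4\<close>]
  show ?A
    by (rule cases(1); rule cases(2);
        simp add: theta_coeff_def theta_coeff_deriv_def fibre_action_def sum_atMost_4;
        use nz in \<open>simp add: field_simps eval_nat_numeral\<close>; fail)
  show ?B
    by (rule cases(1); rule cases(2);
        simp add: theta_coeff_def theta_coeff_deriv_def fibre_action_def sum_atMost_4;
        use nz in \<open>simp add: field_simps eval_nat_numeral\<close>; fail)
  show ?C
    by (rule cases(1); rule cases(2);
        simp add: theta_coeff_def theta_coeff_deriv_def fibre_action_def sum_atMost_4;
        use nz in \<open>simp add: field_simps eval_nat_numeral\<close>; fail)
  show ?D
    by (rule cases(1); rule cases(2);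
        simp add: theta_coeff_def theta_coeff_deriv_def fibre_action_def sum_atMost_4;
        use nz in \<open>simp add: field_simps eval_nat_numeral\<close>; fail)
qed

text \<open>The functions \<open>a, b, c, J\<close> enter only column 0, below its first entry. This
  is what keeps their derivatives out of most torsion coefficients.\<close>

lemma theta_coeff_deriv_base:
  assumes "i \<le> 4" "m \<le> 4" "m \<noteq> 0 \<or> i = 0"
  shows "theta_coeff_deriv a b c J \<delta> s4 s5 s7 da db dc dJ 0 0 0 0 i m = 0"
  using assms(3)
  by (rule_tac le_4_cases[OF assms(1)]; rule_tac le_4_cases[OF assms(2)];
      simp add: theta_coeff_deriv_def)

text \<open>The values of the right-hand sides of (SE) on two vectors with coframe components
  \<open>\<alpha>\<close> and \<open>\<beta>\<close>; \<open>Q\<close> stands for \<open>b\<^sup>2 - 4 a c + M - P\<close>.\<close>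

definition SE_value ::
  "real \<Rightarrow> real \<Rightarrow> real \<Rightarrow> real \<Rightarrow> real \<Rightarrow> (nat \<Rightarrow> real) \<Rightarrow> (nat \<Rightarrow> real) \<Rightarrow> nat \<Rightarrow> real" where
  "SE_value a b c J Q \<alpha> \<beta> m =
     (let w = (\<lambda>i j. \<alpha> i * \<beta> j - \<beta> i * \<alpha> j) in
      [w 1 4 - 3 * w 2 3,
       3/4 * Q * w 0 2 + 3 * c * w 1 2 - 3 * a * w 2 3 + 3 * J * w 2 4,
       1/2 * Q * w 0 3 + 2 * c * w 1 3 - 2 * b * w 2 3 + 2 * J * w 3 4,
       1/4 * Q * w 0 4 + c * w 1 4 - b * w 2 4 + a * w 3 4,
       0] ! m)"

text \<open>The part of \<open>d\<theta>\<^sup>i\<close> that comes from (SE), with the coefficients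
  of \<open>\<theta>\<^sup>i\<close> held constant, evaluated on the dual vectors \<open>j\<close>
  and \<open>k\<close>.\<close>

definition base_torsion ::
  "real \<Rightarrow> real \<Rightarrow> real \<Rightarrow> real \<Rightarrow> real \<Rightarrow> real \<Rightarrow> real \<Rightarrow> real \<Rightarrow> real \<Rightarrow> nat \<Rightarrow> nat \<Rightarrow> nat \<Rightarrow> real" where
  "base_torsion Q a b c J \<delta> s4 s5 s7 i j k =
     (\<Sum>m\<le>4. theta_coeff a b c J \<delta> s4 s5 s7 i m *
        SE_value a b c J Q (\<lambda>n. inv_theta_coeff a b c J \<delta> s4 s5 s7 n j)
          (\<lambda>n. inv_theta_coeff a b c J \<delta> s4 s5 s7 n k) m)"

text \<open>\<open>Q\<close> is absent on the right: in (SE) it multiplies only products with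
  \<open>\<omega>\<^sup>0\<close>, which vanishes on dual vectors of positive index, and for
  \<open>i = 0\<close> only the equation for \<open>d\<omega>\<^sup>0\<close> enters. The triples
  \<open>(1,2,4)\<close> and \<open>(2,3,4)\<close> are left out because the structure equations
  allow them as free torsion.\<close>

lemma base_torsion_values:
  assumes "\<delta> \<noteq> 0" "s5 \<noteq> 0"
  shows
    "base_torsion Q a b c J \<delta> s4 s5 s7 0 0 1 = - s4 / \<delta>^3"
    "base_torsion Q a b c J \<delta> s4 s5 s7 0 0 2 =
       3 * J * s5^2 * s7^3 / \<delta>^4 - 3 * a * s5 * s7^2 / \<delta>^3 - 3 * c / (\<delta> * s5) + 3 * b * s7 / \<delta>^2"
    "base_torsion Q a b c J \<delta> s4 s5 s7 0 0 3 =
       - 9 * J * s5^3 * s7^2 / (2 * \<delta>^4) + 3 * a * s5^2 * s7 / \<delta>^3 - 3 * b * s5 / (2 * \<delta>^2)"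
    "base_torsion Q a b c J \<delta> s4 s5 s7 0 0 4 = 3 * J * s5^4 * s7 / \<delta>^4 - a * s5^3 / \<delta>^3"
    "base_torsion Q a b c J \<delta> s4 s5 s7 0 1 2 = 0"
    "base_torsion Q a b c J \<delta> s4 s5 s7 0 1 3 = 0"
    "base_torsion Q a b c J \<delta> s4 s5 s7 0 1 4 = 1"
    "base_torsion Q a b c J \<delta> s4 s5 s7 0 2 3 = - 3"
    "base_torsion Q a b c J \<delta> s4 s5 s7 0 2 4 = 0"
    "base_torsion Q a b c J \<delta> s4 s5 s7 0 3 4 = 0"
    "base_torsion Q a b c J \<delta> s4 s5 s7 1 1 2 =
       3 * a * s5 * s7^2 / \<delta>^3 - 3 * c / (\<delta> * s5) - 6 * J * s5^2 * s7^3 / \<delta>^4"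
    "base_torsion Q a b c J \<delta> s4 s5 s7 1 1 3 =
       - 3 * a * s5^2 * s7 / \<delta>^3 + 9 * J * s5^3 * s7^2 / \<delta>^4"
    "base_torsion Q a b c J \<delta> s4 s5 s7 1 1 4 = - 6 * J * s5^4 * s7 / \<delta>^4 + a * s5^3 / \<delta>^3"
    "base_torsion Q a b c J \<delta> s4 s5 s7 1 2 3 = 0"
    "base_torsion Q a b c J \<delta> s4 s5 s7 1 3 4 = 0"
    "base_torsion Q a b c J \<delta> s4 s5 s7 2 1 2 =
       - 2 * b * s7^2 / (\<delta>^2 * s5) + 3 * a * s7^3 / \<delta>^3 + c * s7 / (\<delta> * s5^2) - 4 * J * s5 * s7^4 / \<delta>^4"
    "base_torsion Q a b c J \<delta> s4 s5 s7 2 1 3 =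
       2 * b * s7 / \<delta>^2 - 3 * a * s5 * s7^2 / \<delta>^3 + 5 * J * s5^2 * s7^3 / \<delta>^4 - 2 * c / (\<delta> * s5)"
    "base_torsion Q a b c J \<delta> s4 s5 s7 2 1 4 =
       - b * s5 / (2 * \<delta>^2) + a * s5^2 * s7 / \<delta>^3 - 5 * J * s5^3 * s7^2 / (2 * \<delta>^4)"
    "base_torsion Q a b c J \<delta> s4 s5 s7 2 2 3 =
       - b * s5 / (2 * \<delta>^2) + 3 * J * s5^3 * s7^2 / (2 * \<delta>^4)"
    "base_torsion Q a b c J \<delta> s4 s5 s7 2 2 4 = - J * s5^4 * s7 / \<delta>^4"
    "base_torsion Q a b c J \<delta> s4 s5 s7 3 1 2 =
       - 2 * b * s7^3 / (\<delta>^2 * s5^2) + 2 * a * s7^4 / (\<delta>^3 * s5) + 2 * c * s7^2 / (\<delta> * s5^3) - 2 * J * s7^5 / \<delta>^4"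
    "base_torsion Q a b c J \<delta> s4 s5 s7 3 1 3 =
       b * s7^2 / (\<delta>^2 * s5) - a * s7^3 / \<delta>^3 - c * s7 / (\<delta> * s5^2) + J * s5 * s7^4 / \<delta>^4"
    "base_torsion Q a b c J \<delta> s4 s5 s7 3 1 4 = 0"
    "base_torsion Q a b c J \<delta> s4 s5 s7 3 2 3 =
       - 3 * c / (\<delta> * s5) + 2 * b * s7 / \<delta>^2 + 6 * J * s5^2 * s7^3 / \<delta>^4 - 3 * a * s5 * s7^2 / \<delta>^3"
    "base_torsion Q a b c J \<delta> s4 s5 s7 3 2 4 =
       - 5 * J * s5^3 * s7^2 / \<delta>^4 - b * s5 / \<delta>^2 + 2 * a * s5^2 * s7 / \<delta>^3"
    "base_torsion Q a b c J \<delta> s4 s5 s7 3 3 4 = 4 * J * s5^4 * s7 / \<delta>^4 - a * s5^3 / \<delta>^3"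
    "base_torsion Q a b c J \<delta> s4 s5 s7 4 1 2 = 0"
    "base_torsion Q a b c J \<delta> s4 s5 s7 4 1 3 =
       3 * c * s7^2 / (\<delta> * s5^3) + 3 * a * s7^4 / (\<delta>^3 * s5) - 3 * b * s7^3 / (\<delta>^2 * s5^2) - 3 * J * s7^5 / \<delta>^4"
    "base_torsion Q a b c J \<delta> s4 s5 s7 4 1 4 =
       - s4 / \<delta>^3 - 3 * c * s7 / (\<delta> * s5^2) + 3 * J * s5 * s7^4 / \<delta>^4 + 3 * b * s7^2 / (\<delta>^2 * s5) - 3 * a * s7^3 / \<delta>^3"
    "base_torsion Q a b c J \<delta> s4 s5 s7 4 2 3 =
       3 * s4 / \<delta>^3 - 6 * a * s7^3 / \<delta>^3 + 3 * b * s7^2 / (\<delta>^2 * s5) + 9 * J * s5 * s7^4 / \<delta>^4"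
    "base_torsion Q a b c J \<delta> s4 s5 s7 4 2 4 =
       - 9 * J * s5^2 * s7^3 / \<delta>^4 - 3 * b * s7 / \<delta>^2 + 6 * a * s5 * s7^2 / \<delta>^3"
    "base_torsion Q a b c J \<delta> s4 s5 s7 4 3 4 =
       6 * J * s5^3 * s7^2 / \<delta>^4 - 3 * a * s5^2 * s7 / \<delta>^3"
  using assms
  by (simp add: base_torsion_def theta_coeff_def inv_theta_coeff_def SE_value_def sum_atMost_4 Let_def;
      simp add: field_simps eval_nat_numeral; fail)+

section \<open>The provisional coframe on the bundle and its dual frame\<close>

locale engel_coframe =
  fixes U :: "vec5 set" and \<omega> :: "nat \<Rightarrow> vec5 one_form" and a b c J M P :: "vec5 \<Rightarrow> real"
  assumes open_U: "open U"
    and coframe: "coframe_on U {..4} \<omega>"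
    and smooth_abcJ: "smooth_on U a" "smooth_on U b" "smooth_on U c" "smooth_on U J"
    and SE: "SE U \<omega> a b c J M P"
begin

abbreviation "G \<equiv> G9 U"

abbreviation "th \<equiv> theta \<omega> a b c J"

definition A :: "nat \<Rightarrow> nat \<Rightarrow> pt9 \<Rightarrow> real" where
  "A i m p = theta_coeff (a (fst p)) (b (fst p)) (c (fst p)) (J (fst p))
     (fibre_\<delta> p) (fibre_s4 p) (fibre_s5 p) (fibre_s7 p) i m"

definition N :: "nat \<Rightarrow> nat \<Rightarrow> pt9 \<Rightarrow> real" where
  "N m i p = inv_theta_coeff (a (fst p)) (b (fst p)) (c (fst p)) (J (fst p))
     (fibre_\<delta> p) (fibre_s4 p) (fibre_s5 p) (fibre_s7 p) m i"

definition C :: "nat \<Rightarrow> nat \<Rightarrow> nat \<Rightarrow> pt9 \<Rightarrow> real" where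
  "C k i j p = fibre_action (a (fst p)) (b (fst p)) (c (fst p)) (J (fst p))
     (fibre_\<delta> p) (fibre_s5 p) (fibre_s7 p) k i j"

definition E :: "nat \<Rightarrow> vec5 \<Rightarrow> vec5" where
  "E = (SOME E. (\<forall>i. smooth_on U (E i)) \<and> (\<forall>x\<in>U. dual_frame {..4} (\<lambda>i. \<omega> i x) (\<lambda>i. E i x)))"

text \<open>For \<open>k \<le> 4\<close> the fibre component is zero, so along these vectors the
  coefficients of \<open>\<theta>\<^sup>i\<close> vary only through
  \<open>a, b, c, J\<close>.\<close>

definition F :: "nat \<Rightarrow> pt9 \<Rightarrow> pt9" where
  "F k p = (if k \<le> 4 then ((\<Sum>m\<le>4. N m k p *\<^sub>R E m (fst p)), 0) else fibre_vector k p)"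

definition base_form :: "nat \<Rightarrow> pt9 one_form" where
  "base_form k = (if k \<le> 4 then th k else fibre_form k)"

lemma open_G: "open G"
  using open_G9 open_U .

lemma fst_G: "p \<in> G \<Longrightarrow> fst p \<in> U"
  by (auto simp: G9_def)

lemma E_dual_frame: "smooth_on U (E i)" "x \<in> U \<Longrightarrow> dual_frame {..4} (\<lambda>i. \<omega> i x) (\<lambda>i. E i x)"
proof -
  have "\<exists>E. (\<forall>i. smooth_on U (E i)) \<and> (\<forall>x\<in>U. dual_frame {..4} (\<lambda>i. \<omega> i x) (\<lambda>i. E i x))"
    by (rule smooth_dual_frame_exists[OF open_U coframe]) auto
  from someI_ex[OF this] show "smooth_on U (E i)"
    "x \<in> U \<Longrightarrow> dual_frame {..4} (\<lambda>i. \<omega> i x) (\<lambda>i. E i x)"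
    unfolding E_def by auto
qed

lemma smooth_\<omega>: "m \<le> 4 \<Longrightarrow> smooth_on U (\<omega> m)"
  using coframe by (simp add: coframe_on_def)

lemma smooth_base_comp: "smooth_on U f \<Longrightarrow> smooth_on G (\<lambda>p. f (fst p))"
  by (rule smooth_on_comp_linear[OF bounded_linear_fst open_G open_U fst_G])

lemmas smooth_base = smooth_base_comp[OF smooth_abcJ(1)] smooth_base_comp[OF smooth_abcJ(2)]
  smooth_base_comp[OF smooth_abcJ(3)] smooth_base_comp[OF smooth_abcJ(4)]

lemma smooth_A:
  assumes "i \<le> 4" "m \<le> 4"
  shows "smooth_on G (A i m)"
proof -
  note [smooth_intros] = open_G smooth_base
  have "smooth_on G (\<lambda>p. A i m p)"
    unfolding A_def theta_coeff_def
    by (rule le_4_cases[OF assms(1)]; rule le_4_cases[OF assms(2)]; simp)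
      (intro smooth_intros; auto dest: G9_nonzero)+
  then show ?thesis .
qed

lemma smooth_N:
  assumes "m \<le> 4" "i \<le> 4"
  shows "smooth_on G (N m i)"
proof -
  note [smooth_intros] = open_G smooth_base
  have "smooth_on G (\<lambda>p. N m i p)"
    unfolding N_def inv_theta_coeff_def
    by (rule le_4_cases[OF assms(1)]; rule le_4_cases[OF assms(2)]; simp)
      (intro smooth_intros; auto dest: G9_nonzero)+
  then show ?thesis .
qed

lemma smooth_C: "smooth_on G (C k i j)"
proof -
  note [smooth_intros] = open_G smooth_base
  have "smooth_on G (\<lambda>p. C k i j p)"
    unfolding C_def fibre_action_def
    by (intro smooth_on_if smooth_intros) (auto dest: G9_nonzero)
  then show ?thesis .
qed

lemma smooth_F: "smooth_on G (F k)"
proof (cases "k \<le> 4")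
  case True
  have "smooth_on G (\<lambda>p. ((\<Sum>m\<le>4. N m k p *\<^sub>R E m (fst p)), 0 :: real \<times> real \<times> real \<times> real))"
    by (intro smooth_intros open_G smooth_base_comp E_dual_frame(1) smooth_N) (use True in auto)
  then show ?thesis using True by (simp add: F_def[abs_def])
next
  case False
  then show ?thesis using smooth_on_fibre_vector[OF open_U] by (simp add: F_def[abs_def])
qed

lemma theta_eq:
  assumes "i \<le> 4"
  shows "th i p = (\<Sum>m\<le>4. A i m p *\<^sub>R pullback fst (\<omega> m) p)"
  by (rule le_4_cases[OF assms]; cases p)
    (simp_all add: theta_def A_def theta_coeff_def sum_atMost_4 Let_def)

lemma theta_apply:
  assumes "i \<le> 4"
  shows "blinfun_apply (th i p) v = (\<Sum>m\<le>4. A i m p * blinfun_apply (\<omega> m (fst p)) (fst v))"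
  by (simp add: theta_eq[OF assms] blinfun.sum_left blinfun.scaleR_left
      pullback_linear_apply[OF bounded_linear_fst])

lemma smooth_theta:
  assumes "i \<le> 4"
  shows "smooth_on G (th i)"
proof -
  have "smooth_on G (\<lambda>p. \<Sum>m\<le>4. A i m p *\<^sub>R pullback fst (\<omega> m) p)"
    by (intro smooth_intros open_G smooth_A assms
        smooth_on_pullback_linear[OF bounded_linear_fst open_G open_U fst_G smooth_\<omega>]) auto
  then show ?thesis by (rule smooth_on_cong[OF _ open_G]) (simp add: theta_eq[OF assms])
qed

lemma diff_theta: "i \<le> 4 \<Longrightarrow> p \<in> G \<Longrightarrow> th i differentiable (at p)"
  using smooth_on_differentiable[OF smooth_theta] .

lemma N_inverse_A:
  assumes "p \<in> G" "m \<le> 4" "n \<le> 4"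
  shows "(\<Sum>i\<le>4. N m i p * A i n p) = (if m = n then 1 else 0)"
    "(\<Sum>i\<le>4. A m i p * N i n p) = (if m = n then 1 else 0)"
  unfolding N_def A_def using inv_theta_coeff G9_nonzero[OF assms(1)] assms(2,3) by auto

lemma \<omega>_E:
  assumes "x \<in> U" "m \<le> 4" "n \<le> 4"
  shows "blinfun_apply (\<omega> m x) (E n x) = (if m = n then 1 else 0)"
  using dual_frameD(1)[OF E_dual_frame(2)[OF assms(1)]] assms(2,3) by simp

lemma \<omega>_F:
  assumes "p \<in> G" "m \<le> 4" "k \<le> 4"
  shows "blinfun_apply (\<omega> m (fst p)) (fst (F k p)) = N m k p"
proof -
  have "blinfun_apply (\<omega> m (fst p)) (fst (F k p)) =
      (\<Sum>n\<le>4. N n k p * blinfun_apply (\<omega> m (fst p)) (E n (fst p)))"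
    using assms by (simp add: F_def blinfun.sum_right blinfun.scaleR_right)
  also have "\<dots> = (\<Sum>n\<le>4. if n = m then N n k p else 0)"
    using \<omega>_E[OF fst_G[OF assms(1)] assms(2)] by (intro sum.cong) auto
  finally show ?thesis using assms(2) by simp
qed

lemma base_dual:
  assumes p: "p \<in> G"
  shows "dual_frame I9 (\<lambda>k. base_form k p) (\<lambda>k. F k p)"
proof (rule dual_frameI[OF finite_I9])
  fix i j assume ij: "i \<in> I9" "j \<in> I9"
  have sp: "k \<le> 4 \<or> k \<in> {5, 6, 8, 12}" if "k \<in> I9" for k :: nat
    using that by (auto simp: I9_def)
  consider "i \<le> 4" "j \<le> 4" | "i \<le> 4" "j \<in> {5, 6, 8, 12}" | "i \<in> {5, 6, 8, 12}" "j \<le> 4"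
    | "i \<in> {5, 6, 8, 12}" "j \<in> {5, 6, 8, 12}"
    using sp[OF ij(1)] sp[OF ij(2)] by blast
  then show "blinfun_apply (base_form i p) (F j p) = (if i = j then 1 else 0)"
  proof cases
    case 1
    then show ?thesis
      using N_inverse_A(2)[OF p] \<omega>_F[OF p] by (simp add: base_form_def theta_apply)
  next
    case 2
    then show ?thesis by (auto simp: base_form_def F_def theta_apply)
  next
    case 3
    then show ?thesis by (auto simp: base_form_def F_def fibre_form_apply)
  next
    case 4
    then show ?thesis using fibre_dual[OF p 4] by (auto simp: base_form_def F_def)
  qed
next
  fix v assume z: "\<And>i. i \<in> I9 \<Longrightarrow> blinfun_apply (base_form i p) v = 0"
  have th0: "blinfun_apply (th i p) v = 0" if "i \<le> 4" for i
    by (rule le_4_cases[OF that]) (use z[of i] in \<open>simp_all add: base_form_def I9_def\<close>)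
  have "blinfun_apply (\<omega> m (fst p)) (fst v) = 0" if "m \<le> 4" for m
  proof -
    have "blinfun_apply (\<omega> m (fst p)) (fst v) =
        (\<Sum>n\<le>4. if n = m then blinfun_apply (\<omega> n (fst p)) (fst v) else 0)"
      using that by simp
    \<comment> \<open>The inverse matrix is inserted to recover \<open>\<omega> m\<close> from the
      forms \<open>th i\<close>, all of which vanish on \<open>v\<close>.\<close>
    also have "\<dots> = (\<Sum>n\<le>4. \<Sum>i\<le>4. N m i p * A i n p * blinfun_apply (\<omega> n (fst p)) (fst v))"
      by (intro sum.cong refl)
        (simp only: sum_distrib_right[symmetric] atMost_iff N_inverse_A(1)[OF p that]; simp)
    also have "\<dots> = (\<Sum>i\<le>4. N m i p * blinfun_apply (th i p) v)"
      by (subst sum.swap) (simp add: theta_apply sum_distrib_left mult.assoc)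
    finally show ?thesis using th0 by simp
  qed
  then have "fst v = 0"
    by (subst dual_frameD(2)[OF E_dual_frame(2)[OF fst_G[OF p]], of "fst v"]) simp
  moreover have "blinfun_apply (fibre_form k p) v = 0" if "k \<in> {5, 6, 8, 12}" for k
    using z[of k] that by (auto simp: base_form_def I9_def)
  then have "(0, snd v) = (0 :: pt9)"
    by (subst fibre_expansion[OF p, symmetric]) (simp add: zero_prod_def)
  ultimately show "v = 0" by (simp add: prod_eq_iff)
qed

section \<open>Exterior derivatives of the five given forms\<close>

lemma ext_d_theta:
  assumes p: "p \<in> G" and i: "i \<le> 4"
  shows "ext_d (th i) p u v =
    (\<Sum>m\<le>4. frechet_derivative (A i m) (at p) u * blinfun_apply (\<omega> m (fst p)) (fst v)
      - frechet_derivative (A i m) (at p) v * blinfun_apply (\<omega> m (fst p)) (fst u)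
      + A i m p * ext_d (\<omega> m) (fst p) (fst u) (fst v))"
proof -
  have dA: "(A i m has_derivative frechet_derivative (A i m) (at p)) (at p)" if "m \<le> 4" for m
    using smooth_on_differentiable[OF smooth_A[OF i that] p] by (simp add: frechet_derivative_works)
  have d\<omega>: "\<omega> m differentiable (at (fst p))" if "m \<le> 4" for m
    using smooth_on_differentiable[OF smooth_\<omega>[OF that] fst_G[OF p]] .
  have dpb: "pullback fst (\<omega> m) differentiable (at p)" if "m \<le> 4" for m
    by (rule smooth_on_differentiable[OF smooth_on_pullback_linear
          [OF bounded_linear_fst open_G open_U fst_G smooth_\<omega>[OF that]] p])
  have dApb: "(\<lambda>q. A i m q *\<^sub>R pullback fst (\<omega> m) q) differentiable (at p)" if "m \<le> 4" for m
    using has_derivative_scaleR[OF dA[OF that] dpb[OF that, unfolded frechet_derivative_works]]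
    by (rule differentiableI)
  have "ext_d (th i) p u v = ext_d (\<lambda>q. \<Sum>m\<le>4. A i m q *\<^sub>R pullback fst (\<omega> m) q) p u v"
    by (simp add: theta_eq[OF i, abs_def])
  also have "\<dots> = (\<Sum>m\<le>4. ext_d (\<lambda>q. A i m q *\<^sub>R pullback fst (\<omega> m) q) p u v)"
    by (rule ext_d_sum) (use dApb in auto)
  finally show ?thesis
    by (simp add: ext_d_scaleR[OF dA dpb] ext_d_pullback_linear[OF bounded_linear_fst d\<omega>]
        pullback_linear_apply[OF bounded_linear_fst])
qed

lemma A_has_derivative:
  assumes p: "p \<in> G" and "i \<le> 4" "m \<le> 4"
  shows "frechet_derivative (A i m) (at p) u =
    theta_coeff_deriv (a (fst p)) (b (fst p)) (c (fst p)) (J (fst p))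
      (fibre_\<delta> p) (fibre_s4 p) (fibre_s5 p) (fibre_s7 p)
      (frechet_derivative a (at (fst p)) (fst u)) (frechet_derivative b (at (fst p)) (fst u))
      (frechet_derivative c (at (fst p)) (fst u)) (frechet_derivative J (at (fst p)) (fst u))
      (fibre_\<delta> u) (fibre_s4 u) (fibre_s5 u) (fibre_s7 u) i m"
proof -
  have d: "((\<lambda>q :: pt9. f (fst q)) has_derivative (\<lambda>u. frechet_derivative f (at (fst p)) (fst u))) (at p)"
    if "smooth_on U f" for f :: "vec5 \<Rightarrow> real"
    by (rule has_derivative_compose[OF bounded_linear_imp_has_derivative[OF bounded_linear_fst]])
      (use smooth_on_differentiable[OF that fst_G[OF p]] in \<open>simp add: frechet_derivative_works\<close>)
  note l = bounded_linear_fibre[THEN bounded_linear_imp_has_derivative]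
  from theta_coeff_has_derivative[OF d[OF smooth_abcJ(1)] d[OF smooth_abcJ(2)]
      d[OF smooth_abcJ(3)] d[OF smooth_abcJ(4)] l G9_nonzero(1,2)[OF p] assms(2,3)]
  show ?thesis
    unfolding A_def[abs_def] by (metis (no_types, lifting) frechet_derivative_at)
qed

lemma frechet_derivative_0:
  assumes "x \<in> U" "smooth_on U f"
  shows "frechet_derivative f (at x) 0 = 0"
  using linear_frechet_derivative[OF smooth_on_differentiable[OF assms(2,1)]] by (rule linear_0)

lemma A_fibre:
  assumes p: "p \<in> G" and "i \<le> 4" "m \<le> 4" and k: "k \<in> {5, 6, 8, 12}"
  shows "frechet_derivative (A i m) (at p) (fibre_vector k p) = (\<Sum>j\<le>4. C k i j p * A j m p)"
  using theta_coeff_deriv_fibre[OF G9_nonzero(1,2)[OF p] assms(2,3)] k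
  by (auto simp: A_has_derivative[OF assms(1-3)] fibre_vector_def Let_def C_def A_def
      frechet_derivative_0[OF fst_G[OF p]] smooth_abcJ)

text \<open>The pulled back forms and their exterior derivatives vanish on vertical vectors. Only
  the derivative of the coefficient matrix survives, and \<open>A_fibre\<close> turns it back into a
  combination of the \<open>th j\<close>.\<close>

lemma ext_d_fibre:
  assumes p: "p \<in> G" and i: "i \<le> 4" and k: "k \<in> {5, 6, 8, 12}"
  shows "ext_d (th i) p (fibre_vector k p) v = (\<Sum>j\<le>4. C k i j p * blinfun_apply (th j p) v)"
proof -
  have d\<omega>: "ext_d (\<omega> m) (fst p) 0 w = 0" if "m \<le> 4" for m w
    using ext_d_bilinear(2)[OF smooth_on_differentiable[OF smooth_\<omega>[OF that] fst_G[OF p]], of 0 0]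
    by simp
  have "ext_d (th i) p (fibre_vector k p) v =
      (\<Sum>m\<le>4. \<Sum>j\<le>4. C k i j p * A j m p * blinfun_apply (\<omega> m (fst p)) (fst v))"
    using A_fibre[OF p i _ k] d\<omega>
    by (simp add: ext_d_theta[OF p i] sum_distrib_right)
  also have "\<dots> = (\<Sum>j\<le>4. C k i j p * blinfun_apply (th j p) v)"
    by (subst sum.swap) (simp add: theta_apply sum_distrib_left mult.assoc)
  finally show ?thesis .
qed

text \<open>No derivatives of coefficients remain. Those with \<open>m > 0\<close> or
  \<open>i = 0\<close> are constant along \<open>F j\<close> and \<open>F k\<close>; in the
  remaining case \<open>m = 0\<close> with positive \<open>j, k\<close>, they are multiplied by a
  value of \<open>\<omega>\<^sup>0\<close> that vanishes.\<close>

lemma ext_d_base: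
  assumes p: "p \<in> G" and ijk: "i \<le> 4" "j \<le> 4" "k \<le> 4" and "i = 0 \<or> j \<noteq> 0 \<and> k \<noteq> 0"
  shows "ext_d (th i) p (F j p) (F k p) =
    base_torsion ((b (fst p))^2 - 4 * a (fst p) * c (fst p) + M (fst p) - P (fst p))
      (a (fst p)) (b (fst p)) (c (fst p)) (J (fst p))
      (fibre_\<delta> p) (fibre_s4 p) (fibre_s5 p) (fibre_s7 p) i j k"
proof -
  have N0: "N 0 n p = 0" if "n \<noteq> 0" "n \<le> 4" for n
    using that by (auto simp: N_def inv_theta_coeff_def elim!: le_4_cases)
  have dA: "frechet_derivative (A i m) (at p) (F n p) = 0" if "m \<noteq> 0 \<or> i = 0" "m \<le> 4" "n \<le> 4" for m n
    using that theta_coeff_deriv_base[OF ijk(1) that(2,1)]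
    by (simp add: A_has_derivative[OF p ijk(1)] F_def)
  have z: "frechet_derivative (A i m) (at p) (F j p) * N m k p = 0"
    "frechet_derivative (A i m) (at p) (F k p) * N m j p = 0" if "m \<le> 4" for m
    using dA[OF _ that ijk(2)] dA[OF _ that ijk(3)] N0[OF _ ijk(2)] N0[OF _ ijk(3)] assms(5)
    by (cases "m = 0"; auto)+
  have v: "ext_d (\<omega> m) (fst p) (fst (F j p)) (fst (F k p)) =
    SE_value (a (fst p)) (b (fst p)) (c (fst p)) (J (fst p))
      ((b (fst p))^2 - 4 * a (fst p) * c (fst p) + M (fst p) - P (fst p))
      (\<lambda>n. N n j p) (\<lambda>n. N n k p) m" if "m \<le> 4" for m
    using SE[unfolded SE_def Let_def, rule_format, OF fst_G[OF p], of "fst (F j p)" "fst (F k p)"]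
    by (rule_tac le_4_cases[OF that]) (simp_all add: SE_value_def Let_def wedge_def \<omega>_F[OF p] ijk)
  have "ext_d (th i) p (F j p) (F k p) =
    (\<Sum>m\<le>4. A i m p * SE_value (a (fst p)) (b (fst p)) (c (fst p)) (J (fst p))
      ((b (fst p))^2 - 4 * a (fst p) * c (fst p) + M (fst p) - P (fst p))
      (\<lambda>n. N n j p) (\<lambda>n. N n k p) m)"
    unfolding ext_d_theta[OF p ijk(1)]
    by (intro sum.cong refl) (simp only: atMost_iff z v \<omega>_F[OF p _ ijk(2)] \<omega>_F[OF p _ ijk(3)]; simp)
  then show ?thesis by (simp add: base_torsion_def A_def N_def)
qed

section \<open>The normalized coframe\<close>

definition R :: "nat \<Rightarrow> nat \<Rightarrow> nat \<Rightarrow> pt9 \<Rightarrow> real" where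
  "R i j k p = ext_d (th i) p (F j p) (F k p)"

text \<open>The functions \<open>h5, h6, h8, h12\<close> are the components along \<open>\<theta>\<^sup>0, \<dots>, \<theta>\<^sup>4\<close> of the corrections
  to the fibre forms, solved for from the vanishing of the coefficients of \<open>d\<theta>\<^sup>i\<close>.\<close>

definition h58 :: "pt9 \<Rightarrow> real" where
  "h58 p = (R 1 0 1 p - C 6 1 0 p * R 3 1 2 p / 2) / 3"

text \<open>For \<open>k > 0\<close> this cancels the
  \<open>\<theta>\<^sup>0 \<and> \<theta>\<^sup>k\<close> term of \<open>d\<theta>\<^sup>0\<close>.
  For \<open>k = 0\<close>, the \<open>\<theta>\<^sup>0 \<and> \<theta>\<^sup>2\<close> term of
  \<open>d\<theta>\<^sup>2\<close> prescribes \<open>3 * h5 0 + h8 0\<close>, while the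
  \<open>\<theta>\<^sup>0 \<and> \<theta>\<^sup>1\<close> term of \<open>d\<theta>\<^sup>1\<close>
  prescribes \<open>h5 0 + h8 0\<close>, which is \<open>h58\<close>.\<close>

definition h5 :: "nat \<Rightarrow> pt9 \<Rightarrow> real" where
  "h5 k p = (if k = 0 then (R 2 0 2 p - h58 p) / 2 else - R 0 0 k p / 6)"

text \<open>For \<open>k = 1\<close> the condition is the absence of
  \<open>\<theta>\<^sup>1 \<and> \<theta>\<^sup>3\<close> in \<open>d\<theta>\<^sup>3\<close>, for
  larger \<open>k\<close> that of \<open>\<theta>\<^sup>1 \<and> \<theta>\<^sup>k\<close> in
  \<open>d\<theta>\<^sup>1\<close>.\<close>

definition h8 :: "nat \<Rightarrow> pt9 \<Rightarrow> real" where
  "h8 k p = (if k = 0 then h58 p - h5 0 p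
     else if k = 1 then 3 * h5 1 p - R 3 1 3 p
     else - R 1 1 k p / 3 - h5 k p)"

text \<open>The conditions are the absence of
  \<open>\<theta>\<^sup>0 \<and> \<theta>\<^sup>1\<close> in \<open>d\<theta>\<^sup>2\<close> for
  \<open>k = 0\<close>, of \<open>\<theta>\<^sup>1 \<and> \<theta>\<^sup>2\<close> in
  \<open>d\<theta>\<^sup>3\<close> for \<open>k = 1\<close>, and of
  \<open>\<theta>\<^sup>1 \<and> \<theta>\<^sup>k\<close> in \<open>d\<theta>\<^sup>2\<close> for
  larger \<open>k\<close>.\<close>

definition h6 :: "nat \<Rightarrow> pt9 \<Rightarrow> real" where
  "h6 k p = (if k = 0 then - R 2 0 1 p
     else if k = 1 then - R 3 1 2 p / 2
     else if k = 2 then R 2 1 2 p - 3 * h5 1 p - h8 1 p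
     else R 2 1 k p)"

text \<open>Direction 12 is not corrected yet, because \<open>h12\<close> is computed from these
  vectors.\<close>

definition base_vector :: "nat \<Rightarrow> pt9 \<Rightarrow> pt9" where
  "base_vector k p = F k p - h5 k p *\<^sub>R fibre_vector 5 p - h6 k p *\<^sub>R fibre_vector 6 p
     - h8 k p *\<^sub>R fibre_vector 8 p"

definition theta5 :: "pt9 one_form" where
  "theta5 p = fibre_form 5 p + (\<Sum>j\<le>4. h5 j p *\<^sub>R th j p)"

definition theta6 :: "pt9 one_form" where
  "theta6 p = fibre_form 6 p + (\<Sum>j\<le>4. h6 j p *\<^sub>R th j p)"

definition theta8 :: "pt9 one_form" where
  "theta8 p = fibre_form 8 p + (\<Sum>j\<le>4. h8 j p *\<^sub>R th j p)"

definition h12 :: "nat \<Rightarrow> pt9 \<Rightarrow> real" where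
  "h12 k p =
     (let g = (\<lambda>k. ext_d (th 4) p (base_vector 0 p) (base_vector k p) / 6)
      in if k = 0 then ext_d theta5 p (base_vector 0 p)
             (base_vector 1 p - g 1 *\<^sub>R fibre_vector 12 p)
         else g k)"

text \<open>The multiple of \<open>theta6\<close> removes the
  \<open>\<theta>\<^sup>0 \<and> \<theta>\<^sup>6\<close> term that the fibre action would leave in
  \<open>d\<theta>\<^sup>4\<close>; \<open>frame 6\<close> is shifted accordingly.\<close>

definition theta12 :: "pt9 one_form" where
  "theta12 p = fibre_form 12 p - h5 2 p *\<^sub>R theta6 p + (\<Sum>j\<le>4. h12 j p *\<^sub>R th j p)"

definition Theta :: "nat \<Rightarrow> pt9 one_form" where
  "Theta k = (if k \<le> 4 then th k else if k = 5 then theta5 else if k = 6 then theta6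
     else if k = 8 then theta8 else theta12)"

definition frame :: "nat \<Rightarrow> pt9 \<Rightarrow> pt9" where
  "frame k p = (if k \<le> 4 then base_vector k p - h12 k p *\<^sub>R fibre_vector 12 p
     else if k = 6 then fibre_vector 6 p + h5 2 p *\<^sub>R fibre_vector 12 p
     else fibre_vector k p)"

text \<open>The signs match the two terms that the structure equations write with a minus. The value
  0 for \<open>i > 4\<close> makes the functions smooth for all indices.\<close>

definition torsion :: "nat \<Rightarrow> nat \<Rightarrow> nat \<Rightarrow> pt9 \<Rightarrow> real" where
  "torsion i j k p =
     (if i \<le> 4 then (if (i, j, k) = (2, 0, 4) \<or> (i, j, k) = (3, 0, 3) then - 1 else 1) *
        ext_d (th i) p (frame j p) (frame k p) else 0)"

section \<open>Smoothness of the corrected forms and vectors\<close>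

lemma smooth_R: "i \<le> 4 \<Longrightarrow> smooth_on G (R i j k)"
  unfolding R_def[abs_def] by (intro smooth_on_ext_d open_G smooth_theta smooth_F)

lemma smooth_h58: "smooth_on G h58"
  unfolding h58_def[abs_def] by (intro smooth_intros open_G smooth_R smooth_C) auto

lemma smooth_h5: "smooth_on G (h5 k)"
  unfolding h5_def[abs_def] by (intro smooth_on_if smooth_intros open_G smooth_R smooth_h58) auto

lemma smooth_h8: "smooth_on G (h8 k)"
  unfolding h8_def[abs_def]
  by (intro smooth_on_if smooth_intros open_G smooth_R smooth_h58 smooth_h5) auto

lemma smooth_h6: "smooth_on G (h6 k)"
  unfolding h6_def[abs_def]
  by (intro smooth_on_if smooth_intros open_G smooth_R smooth_h5 smooth_h8) auto

lemma smooth_base_vector: "smooth_on G (base_vector k)"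
  unfolding base_vector_def[abs_def]
  by (intro smooth_intros open_G smooth_F smooth_h5 smooth_h6 smooth_h8
      smooth_on_fibre_vector[OF open_U])

lemma smooth_theta568: "smooth_on G theta5" "smooth_on G theta6" "smooth_on G theta8"
  unfolding theta5_def[abs_def] theta6_def[abs_def] theta8_def[abs_def]
  by (intro smooth_intros open_G smooth_h5 smooth_h6 smooth_h8 smooth_theta
      smooth_on_fibre_form[OF open_U]; simp)+

lemma smooth_h12: "smooth_on G (h12 k)"
  unfolding h12_def[abs_def] Let_def
  by (intro smooth_on_if smooth_intros open_G smooth_base_vector smooth_theta568 smooth_theta
      smooth_on_fibre_vector[OF open_U]) auto

lemma smooth_Theta: "smooth_on G (Theta k)"
proof -
  have "smooth_on G theta12"
    unfolding theta12_def[abs_def]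
    by (intro smooth_intros open_G smooth_h5 smooth_h12 smooth_theta smooth_theta568
        smooth_on_fibre_form[OF open_U]) auto
  then show ?thesis by (simp add: Theta_def smooth_theta568 smooth_theta)
qed

lemma smooth_frame: "smooth_on G (frame k)"
  unfolding frame_def[abs_def]
  by (intro smooth_on_if smooth_intros open_G smooth_base_vector smooth_h5 smooth_h12
      smooth_on_fibre_vector[OF open_U])

lemma smooth_torsion: "smooth_on G (torsion i j k)"
proof (cases "i \<le> 4")
  case True
  have "smooth_on G (\<lambda>p. (if (i, j, k) = (2, 0, 4) \<or> (i, j, k) = (3, 0, 3) then - 1 else 1) *
        ext_d (th i) p (frame j p) (frame k p))"
    by (intro smooth_intros open_G smooth_frame smooth_theta True)
  then show ?thesis using True by (simp add: torsion_def[abs_def])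
qed (simp add: torsion_def[abs_def] smooth_on_const open_G)

section \<open>Duality of the corrected coframe and frame\<close>

lemma theta_F:
  assumes "p \<in> G" "i \<le> 4" "k \<in> I9"
  shows "blinfun_apply (th i p) (F k p) = (if i = k then 1 else 0)"
proof -
  have "i \<in> I9" by (rule le_4_cases[OF assms(2)]) (simp_all add: I9_def)
  from dual_frameD(1)[OF base_dual[OF assms(1)] this assms(3)] show ?thesis
    using assms(2) by (simp add: base_form_def)
qed

lemma theta_fibre_vector:
  assumes "i \<le> 4"
  shows "blinfun_apply (th i p) (fibre_vector k p) = 0"
  using assms by (simp add: theta_apply)

lemma fibre_form_F: "k \<le> 4 \<Longrightarrow> l \<in> {5, 6, 8, 12} \<Longrightarrow> blinfun_apply (fibre_form l p) (F k p) = 0"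
  by (auto simp: F_def fibre_form_apply)

lemma theta_base_vector:
  assumes "p \<in> G" "i \<le> 4" "k \<le> 4"
  shows "blinfun_apply (th i p) (base_vector k p) = (if i = k then 1 else 0)"
proof -
  have "k \<in> I9" by (rule le_4_cases[OF assms(3)]) (simp_all add: I9_def)
  then show ?thesis
    using assms by (simp add: base_vector_def blinfun.bilinear_simps theta_F theta_fibre_vector)
qed

lemma sum_delta_atMost_4:
  fixes h :: "nat \<Rightarrow> real"
  assumes "k \<le> 4"
  shows "(\<Sum>j\<le>4. h j * (if j = k then 1 else 0)) = h k"
proof -
  have "(\<Sum>j\<le>4. h j * (if j = k then 1 else 0)) = (\<Sum>j\<le>4. if j = k then h j else 0)"
    by (intro sum.cong) auto
  then show ?thesis using assms by simp
qed

lemma frame_dual: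
  assumes p: "p \<in> G"
  shows "dual_frame I9 (\<lambda>k. Theta k p) (\<lambda>k. frame k p)"
proof (rule dual_frameI[OF finite_I9])
  fix i j assume ij: "i \<in> I9" "j \<in> I9"
  have I9: "k \<le> 4 \<or> k = 5 \<or> k = 6 \<or> k = 8 \<or> k = 12" if "k \<in> I9" for k :: nat
    using that by (auto simp: I9_def)
  note s = Theta_def frame_def theta5_def theta6_def theta8_def theta12_def blinfun.bilinear_simps
    blinfun.sum_left theta_base_vector[OF p] theta_fibre_vector sum_delta_atMost_4
  have fb: "blinfun_apply (fibre_form 5 p) (base_vector k p) = - h5 k p"
    "blinfun_apply (fibre_form 6 p) (base_vector k p) = - h6 k p"
    "blinfun_apply (fibre_form 8 p) (base_vector k p) = - h8 k p"
    "blinfun_apply (fibre_form 12 p) (base_vector k p) = 0" if "k \<le> 4" for k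
    using that by (simp_all add: base_vector_def blinfun.bilinear_simps fibre_form_F fibre_dual[OF p])
  show "blinfun_apply (Theta i p) (frame j p) = (if i = j then 1 else 0)"
    using I9[OF ij(1)] I9[OF ij(2)]
    by (elim disjE) (simp_all add: s fb fibre_dual[OF p])
next
  fix v assume z: "\<And>i. i \<in> I9 \<Longrightarrow> blinfun_apply (Theta i p) v = 0"
  have th0: "blinfun_apply (th i p) v = 0" if "i \<le> 4" for i
    by (rule le_4_cases[OF that]) (use z[of i] in \<open>simp_all add: Theta_def I9_def\<close>)
  have 568: "blinfun_apply (fibre_form 5 p) v = 0" "blinfun_apply (fibre_form 6 p) v = 0"
    "blinfun_apply (fibre_form 8 p) v = 0"
    using z[of 5] z[of 6] z[of 8] th0
    by (simp_all add: Theta_def I9_def theta5_def theta6_def theta8_def blinfun.bilinear_simps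
        blinfun.sum_left)
  have 12: "blinfun_apply (fibre_form 12 p) v = 0"
    using z[of 12] z[of 6] th0
    by (simp add: Theta_def I9_def theta12_def blinfun.bilinear_simps blinfun.sum_left)
  have "blinfun_apply (base_form k p) v = 0" if "k \<in> I9" for k
    using that th0 568 12 by (auto simp: I9_def base_form_def)
  then show "v = 0"
    by (subst dual_frameD(2)[OF base_dual[OF p], of v]) simp
qed

section \<open>Coefficients of \<open>d\<theta>\<^sup>i\<close> in the corrected frame\<close>

lemma ext_d_fibre_F:
  assumes "p \<in> G" "i \<le> 4" "l \<in> {5, 6, 8, 12}"
  shows "k \<le> 4 \<Longrightarrow> ext_d (th i) p (fibre_vector l p) (F k p) = C l i k p"
    "k \<le> 4 \<Longrightarrow> ext_d (th i) p (fibre_vector l p) (base_vector k p) = C l i k p"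
    "ext_d (th i) p (fibre_vector l p) (fibre_vector m p) = 0"
    "k \<le> 4 \<Longrightarrow> ext_d (th i) p (F k p) (fibre_vector l p) = - C l i k p"
    "k \<le> 4 \<Longrightarrow> ext_d (th i) p (base_vector k p) (fibre_vector l p) = - C l i k p"
proof -
  have "k \<in> I9" if "k \<le> 4" for k :: nat
    by (rule le_4_cases[OF that]) (simp_all add: I9_def)
  then show F: "ext_d (th i) p (fibre_vector l p) (F k p) = C l i k p" if "k \<le> 4"
    using that by (simp add: ext_d_fibre[OF assms] theta_F[OF assms(1)] sum_delta_atMost_4)
  show B: "ext_d (th i) p (fibre_vector l p) (base_vector k p) = C l i k p" if "k \<le> 4"
    using that by (simp add: ext_d_fibre[OF assms] theta_base_vector[OF assms(1)] sum_delta_atMost_4)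
  show "ext_d (th i) p (fibre_vector l p) (fibre_vector m p) = 0"
    by (simp add: ext_d_fibre[OF assms] theta_fibre_vector)
  show "ext_d (th i) p (F k p) (fibre_vector l p) = - C l i k p" if "k \<le> 4"
    using F[OF that] ext_d_skew[of "th i" p "F k p"] by simp
  show "ext_d (th i) p (base_vector k p) (fibre_vector l p) = - C l i k p" if "k \<le> 4"
    using B[OF that] ext_d_skew[of "th i" p "base_vector k p"] by simp
qed

text \<open>\<open>d\<theta>\<^sup>i\<close> vanishes on two vertical vectors, so no product of two
  corrections appears and the conditions on \<open>h5, h6, h8, h12\<close> are linear.\<close>

lemma ext_d_frame:
  assumes "p \<in> G" "i \<le> 4" "j \<le> 4" "k \<le> 4"
  shows "ext_d (th i) p (frame j p) (frame k p) = R i j k p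
    - (h5 j p * C 5 i k p + h6 j p * C 6 i k p + h8 j p * C 8 i k p + h12 j p * C 12 i k p)
    + (h5 k p * C 5 i j p + h6 k p * C 6 i j p + h8 k p * C 8 i j p + h12 k p * C 12 i j p)"
  using assms
  by (simp add: frame_def base_vector_def ext_d_bilinear[OF diff_theta] ext_d_fibre_F R_def
      algebra_simps)

lemma ext_d_frame_fibre:
  assumes "p \<in> G" "i \<le> 4"
  shows "j \<le> 4 \<Longrightarrow> ext_d (th i) p (frame j p) (frame 5 p) = - C 5 i j p"
    "j \<le> 4 \<Longrightarrow> ext_d (th i) p (frame j p) (frame 8 p) = - C 8 i j p"
    "j \<le> 4 \<Longrightarrow> ext_d (th i) p (frame j p) (frame 12 p) = - C 12 i j p"
    "j \<le> 4 \<Longrightarrow> ext_d (th i) p (frame j p) (frame 6 p) = - C 6 i j p - h5 2 p * C 12 i j p"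
    "l \<in> {5, 6, 8, 12} \<Longrightarrow> m \<in> {5, 6, 8, 12} \<Longrightarrow> ext_d (th i) p (frame l p) (frame m p) = 0"
  using assms
  by (auto simp: frame_def ext_d_bilinear[OF diff_theta] ext_d_fibre_F)

text \<open>This is the purpose of \<open>h12 k\<close> for \<open>k > 0\<close>: the action of
  index 12 has the single nonzero entry \<open>C 12 4 0 = - 6\<close>, which the factor
  \<open>1 / 6\<close> in \<open>h12\<close> compensates.\<close>

lemma ext_d_theta_4_frame:
  assumes "p \<in> G" "k \<in> {1, 2, 3, 4}"
  shows "ext_d (th 4) p (frame 0 p) (frame k p) = 0"
  using assms
  by (auto simp: frame_def ext_d_bilinear[OF diff_theta] ext_d_fibre_F C_def fibre_action_def h12_def
      Let_def)

text \<open>Some of these hold by the choice of \<open>h5, h6, h8\<close>; the others are the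
  compatibility conditions, rational identities between values of \<open>base_torsion\<close>.
  \<open>h12\<close> drops out, since its action has an entry only in row 4, column 0, and the
  listed coefficients of \<open>d\<theta>\<^sup>4\<close> have positive lower indices.\<close>

lemma frame_torsion:
  assumes p: "p \<in> G"
  shows
    "ext_d (th 0) p (frame 1 p) (frame 4 p) = 1"
    "ext_d (th 0) p (frame 2 p) (frame 3 p) = - 3"
    "ext_d (th 0) p (frame 0 p) (frame 1 p) = 0"
    "ext_d (th 0) p (frame 0 p) (frame 2 p) = 0"
    "ext_d (th 0) p (frame 0 p) (frame 3 p) = 0"
    "ext_d (th 0) p (frame 0 p) (frame 4 p) = 0"
    "ext_d (th 0) p (frame 1 p) (frame 2 p) = 0"
    "ext_d (th 0) p (frame 1 p) (frame 3 p) = 0"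
    "ext_d (th 0) p (frame 2 p) (frame 4 p) = 0"
    "ext_d (th 0) p (frame 3 p) (frame 4 p) = 0"
    "ext_d (th 1) p (frame 0 p) (frame 1 p) = 0"
    "ext_d (th 1) p (frame 1 p) (frame 2 p) = 0"
    "ext_d (th 1) p (frame 1 p) (frame 3 p) = 0"
    "ext_d (th 1) p (frame 1 p) (frame 4 p) = 0"
    "ext_d (th 1) p (frame 2 p) (frame 3 p) = 0"
    "ext_d (th 1) p (frame 3 p) (frame 4 p) = 0"
    "ext_d (th 2) p (frame 0 p) (frame 1 p) = 0"
    "ext_d (th 2) p (frame 0 p) (frame 2 p) = 0"
    "ext_d (th 2) p (frame 1 p) (frame 2 p) = 0"
    "ext_d (th 2) p (frame 1 p) (frame 3 p) = 0"
    "ext_d (th 2) p (frame 1 p) (frame 4 p) = 0"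
    "ext_d (th 2) p (frame 2 p) (frame 3 p) = 0"
    "ext_d (th 2) p (frame 2 p) (frame 4 p) = 0"
    "ext_d (th 3) p (frame 1 p) (frame 2 p) = 0"
    "ext_d (th 3) p (frame 1 p) (frame 3 p) = 0"
    "ext_d (th 3) p (frame 1 p) (frame 4 p) = 0"
    "ext_d (th 3) p (frame 2 p) (frame 3 p) = 0"
    "ext_d (th 3) p (frame 2 p) (frame 4 p) = 0"
    "ext_d (th 3) p (frame 3 p) (frame 4 p) = 0"
    "ext_d (th 4) p (frame 1 p) (frame 2 p) = 0"
    "ext_d (th 4) p (frame 1 p) (frame 3 p) = 0"
    "ext_d (th 4) p (frame 1 p) (frame 4 p) = 0"
    "ext_d (th 4) p (frame 2 p) (frame 3 p) = 0"
    "ext_d (th 4) p (frame 2 p) (frame 4 p) = 0"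
    "ext_d (th 4) p (frame 3 p) (frame 4 p) = 0"
proof -
  \<comment> \<open>The side condition keeps \<open>R 1 0 1\<close>, \<open>R 2 0 1\<close> and
    \<open>R 2 0 2\<close> symbolic. They contain derivatives of \<open>a, b, c, J\<close> and
    cancel against \<open>h58\<close>, \<open>h6 0\<close> and \<open>h5 0\<close>.\<close>
  have Rv: "R i j k p =
    base_torsion ((b (fst p))^2 - 4 * a (fst p) * c (fst p) + M (fst p) - P (fst p))
      (a (fst p)) (b (fst p)) (c (fst p)) (J (fst p))
      (fibre_\<delta> p) (fibre_s4 p) (fibre_s5 p) (fibre_s7 p) i j k"
    if "i \<le> 4" "j \<le> 4" "k \<le> 4" "i = 0 \<or> j \<noteq> 0 \<and> k \<noteq> 0" for i j k
    using ext_d_base[OF p that] by (simp add: R_def)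
  note nz = G9_nonzero(1,2)[OF p]
  note s = ext_d_frame[OF p] h5_def h6_def h8_def h58_def C_def fibre_action_def
    Rv base_torsion_values[OF nz]
  show "ext_d (th 0) p (frame 1 p) (frame 4 p) = 1"
    by (simp add: s del: One_nat_def; use nz in \<open>simp add: field_simps eval_nat_numeral\<close>; fail)
  show "ext_d (th 0) p (frame 2 p) (frame 3 p) = - 3"
    by (simp add: s del: One_nat_def; use nz in \<open>simp add: field_simps eval_nat_numeral\<close>; fail)
  show "ext_d (th 0) p (frame 0 p) (frame 1 p) = 0"
    by (simp add: s del: One_nat_def; use nz in \<open>simp add: field_simps eval_nat_numeral\<close>; fail)
  show "ext_d (th 0) p (frame 0 p) (frame 2 p) = 0"
    by (simp add: s del: One_nat_def; use nz in \<open>simp add: field_simps eval_nat_numeral\<close>; fail)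
  show "ext_d (th 0) p (frame 0 p) (frame 3 p) = 0"
    by (simp add: s del: One_nat_def; use nz in \<open>simp add: field_simps eval_nat_numeral\<close>; fail)
  show "ext_d (th 0) p (frame 0 p) (frame 4 p) = 0"
    by (simp add: s del: One_nat_def; use nz in \<open>simp add: field_simps eval_nat_numeral\<close>; fail)
  show "ext_d (th 0) p (frame 1 p) (frame 2 p) = 0"
    by (simp add: s del: One_nat_def; use nz in \<open>simp add: field_simps eval_nat_numeral\<close>; fail)
  show "ext_d (th 0) p (frame 1 p) (frame 3 p) = 0"
    by (simp add: s del: One_nat_def; use nz in \<open>simp add: field_simps eval_nat_numeral\<close>; fail)
  show "ext_d (th 0) p (frame 2 p) (frame 4 p) = 0"
    by (simp add: s del: One_nat_def; use nz in \<open>simp add: field_simps eval_nat_numeral\<close>; fail)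
  show "ext_d (th 0) p (frame 3 p) (frame 4 p) = 0"
    by (simp add: s del: One_nat_def; use nz in \<open>simp add: field_simps eval_nat_numeral\<close>; fail)
  show "ext_d (th 1) p (frame 0 p) (frame 1 p) = 0"
    by (simp add: s del: One_nat_def; use nz in \<open>simp add: field_simps eval_nat_numeral\<close>; fail)
  show "ext_d (th 1) p (frame 1 p) (frame 2 p) = 0"
    by (simp add: s del: One_nat_def; use nz in \<open>simp add: field_simps eval_nat_numeral\<close>; fail)
  show "ext_d (th 1) p (frame 1 p) (frame 3 p) = 0"
    by (simp add: s del: One_nat_def; use nz in \<open>simp add: field_simps eval_nat_numeral\<close>; fail)
  show "ext_d (th 1) p (frame 1 p) (frame 4 p) = 0"
    by (simp add: s del: One_nat_def; use nz in \<open>simp add: field_simps eval_nat_numeral\<close>; fail)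
  show "ext_d (th 1) p (frame 2 p) (frame 3 p) = 0"
    by (simp add: s del: One_nat_def; use nz in \<open>simp add: field_simps eval_nat_numeral\<close>; fail)
  show "ext_d (th 1) p (frame 3 p) (frame 4 p) = 0"
    by (simp add: s del: One_nat_def; use nz in \<open>simp add: field_simps eval_nat_numeral\<close>; fail)
  show "ext_d (th 2) p (frame 0 p) (frame 1 p) = 0"
    by (simp add: s del: One_nat_def; use nz in \<open>simp add: field_simps eval_nat_numeral\<close>; fail)
  show "ext_d (th 2) p (frame 0 p) (frame 2 p) = 0"
    by (simp add: s del: One_nat_def; use nz in \<open>simp add: field_simps eval_nat_numeral\<close>; fail)
  show "ext_d (th 2) p (frame 1 p) (frame 2 p) = 0"
    by (simp add: s del: One_nat_def; use nz in \<open>simp add: field_simps eval_nat_numeral\<close>; fail)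
  show "ext_d (th 2) p (frame 1 p) (frame 3 p) = 0"
    by (simp add: s del: One_nat_def; use nz in \<open>simp add: field_simps eval_nat_numeral\<close>; fail)
  show "ext_d (th 2) p (frame 1 p) (frame 4 p) = 0"
    by (simp add: s del: One_nat_def; use nz in \<open>simp add: field_simps eval_nat_numeral\<close>; fail)
  show "ext_d (th 2) p (frame 2 p) (frame 3 p) = 0"
    by (simp add: s del: One_nat_def; use nz in \<open>simp add: field_simps eval_nat_numeral\<close>; fail)
  show "ext_d (th 2) p (frame 2 p) (frame 4 p) = 0"
    by (simp add: s del: One_nat_def; use nz in \<open>simp add: field_simps eval_nat_numeral\<close>; fail)
  show "ext_d (th 3) p (frame 1 p) (frame 2 p) = 0"
    by (simp add: s del: One_nat_def; use nz in \<open>simp add: field_simps eval_nat_numeral\<close>; fail)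
  show "ext_d (th 3) p (frame 1 p) (frame 3 p) = 0"
    by (simp add: s del: One_nat_def; use nz in \<open>simp add: field_simps eval_nat_numeral\<close>; fail)
  show "ext_d (th 3) p (frame 1 p) (frame 4 p) = 0"
    by (simp add: s del: One_nat_def; use nz in \<open>simp add: field_simps eval_nat_numeral\<close>; fail)
  show "ext_d (th 3) p (frame 2 p) (frame 3 p) = 0"
    by (simp add: s del: One_nat_def; use nz in \<open>simp add: field_simps eval_nat_numeral\<close>; fail)
  show "ext_d (th 3) p (frame 2 p) (frame 4 p) = 0"
    by (simp add: s del: One_nat_def; use nz in \<open>simp add: field_simps eval_nat_numeral\<close>; fail)
  show "ext_d (th 3) p (frame 3 p) (frame 4 p) = 0"
    by (simp add: s del: One_nat_def; use nz in \<open>simp add: field_simps eval_nat_numeral\<close>; fail)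
  show "ext_d (th 4) p (frame 1 p) (frame 2 p) = 0"
    by (simp add: s del: One_nat_def; use nz in \<open>simp add: field_simps eval_nat_numeral\<close>; fail)
  show "ext_d (th 4) p (frame 1 p) (frame 3 p) = 0"
    by (simp add: s del: One_nat_def; use nz in \<open>simp add: field_simps eval_nat_numeral\<close>; fail)
  show "ext_d (th 4) p (frame 1 p) (frame 4 p) = 0"
    by (simp add: s del: One_nat_def; use nz in \<open>simp add: field_simps eval_nat_numeral\<close>; fail)
  show "ext_d (th 4) p (frame 2 p) (frame 3 p) = 0"
    by (simp add: s del: One_nat_def; use nz in \<open>simp add: field_simps eval_nat_numeral\<close>; fail)
  show "ext_d (th 4) p (frame 2 p) (frame 4 p) = 0"
    by (simp add: s del: One_nat_def; use nz in \<open>simp add: field_simps eval_nat_numeral\<close>; fail)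
  show "ext_d (th 4) p (frame 3 p) (frame 4 p) = 0"
    by (simp add: s del: One_nat_def; use nz in \<open>simp add: field_simps eval_nat_numeral\<close>; fail)
qed

section \<open>Verification of the structure equations\<close>

lemma ext_d_theta_expansion:
  assumes p: "p \<in> G" and i: "i \<le> 4"
  shows "ext_d (th i) p u v = (\<Sum>(j, k) | j \<in> I9 \<and> k \<in> I9 \<and> j < k.
    ext_d (th i) p (frame j p) (frame k p) * wedge (Theta j p) (Theta k p) u v)"
  by (rule alternating_expansion[OF finite_I9 frame_dual[OF p]])
    (rule ext_d_linear[OF diff_theta[OF i p]] ext_d_skew)+

lemma structure_equations_Theta: "structure_equations G Theta torsion"
  unfolding structure_equations_def Let_def
proof (intro ballI allI)
  fix p u v assume p: "p \<in> G"
  note e = ext_d_theta_expansion[OF p, unfolded sum_I9_pairs]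
  note s = frame_torsion[OF p] ext_d_theta_4_frame[OF p] ext_d_frame_fibre[OF p] C_def
    fibre_action_def torsion_def
  have Th: "Theta 0 = th 0" "Theta 1 = th 1" "Theta 2 = th 2" "Theta 3 = th 3" "Theta 4 = th 4"
    by (simp_all add: Theta_def)
  let ?w = "\<lambda>i j. wedge (Theta i p) (Theta j p) u v"
  have "ext_d (th 0) p u v = - 6 * ?w 0 5 + ?w 1 4 - 3 * ?w 2 3"
    by (subst e) (simp_all add: s del: One_nat_def)
  moreover have "ext_d (th 1) p u v = - 3 * ?w 1 5 - 3 * ?w 1 8
      + torsion 1 0 2 p * ?w 0 2 + torsion 1 0 3 p * ?w 0 3 + torsion 1 0 4 p * ?w 0 4
      + torsion 1 0 6 p * ?w 0 6 + torsion 1 2 4 p * ?w 2 4"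
    by (subst e) (simp_all add: s del: One_nat_def)
  moreover have "ext_d (th 2) p u v = ?w 1 6 - 3 * ?w 2 5 - ?w 2 8
      + torsion 2 0 3 p * ?w 0 3 - torsion 2 0 4 p * ?w 0 4 + torsion 2 3 4 p * ?w 3 4"
    by (subst e) (simp_all add: s del: One_nat_def)
  moreover have "ext_d (th 3) p u v = 2 * ?w 2 6 - 3 * ?w 3 5 + ?w 3 8
      + torsion 3 0 1 p * ?w 0 1 + torsion 3 0 2 p * ?w 0 2 - torsion 3 0 3 p * ?w 0 3
      + torsion 3 0 4 p * ?w 0 4"
    by (subst e) (simp_all add: s del: One_nat_def)
  moreover have "ext_d (th 4) p u v = 6 * ?w 0 12 + 3 * ?w 3 6 - 3 * ?w 4 5 + 3 * ?w 4 8"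
  proof -
    \<comment> \<open>The entry \<open>C 6 4 0\<close> is the negative of the
      \<open>\<theta>\<^sup>0 \<and> \<theta>\<^sup>2\<close> coefficient of
      \<open>d\<theta>\<^sup>0\<close> in the provisional frame. Hence the multiple of
      \<open>fibre_vector 12\<close> in \<open>frame 6\<close> cancels it.\<close>
    have "h5 2 p = - R 0 0 2 p / 6" by (simp add: h5_def)
    then have "C 6 4 0 p = 6 * h5 2 p"
      using ext_d_base[OF p, of 0 0 2] base_torsion_values(2)[OF G9_nonzero(1,2)[OF p]]
      by (simp add: R_def C_def fibre_action_def)
    then have "ext_d (th 4) p (frame 0 p) (frame 6 p) = 0"
      by (simp add: ext_d_frame_fibre(4)[OF p]) (simp add: C_def fibre_action_def)
    then show ?thesis
      by (subst e) (simp_all add: s del: One_nat_def)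
  qed
  ultimately show "ext_d (Theta 0) p u v = - 6 * ?w 0 5 + ?w 1 4 - 3 * ?w 2 3 \<and>
      ext_d (Theta 1) p u v = - 3 * ?w 1 5 - 3 * ?w 1 8
        + torsion 1 0 2 p * ?w 0 2 + torsion 1 0 3 p * ?w 0 3 + torsion 1 0 4 p * ?w 0 4
        + torsion 1 0 6 p * ?w 0 6 + torsion 1 2 4 p * ?w 2 4 \<and>
      ext_d (Theta 2) p u v = ?w 1 6 - 3 * ?w 2 5 - ?w 2 8
        + torsion 2 0 3 p * ?w 0 3 - torsion 2 0 4 p * ?w 0 4 + torsion 2 3 4 p * ?w 3 4 \<and>
      ext_d (Theta 3) p u v = 2 * ?w 2 6 - 3 * ?w 3 5 + ?w 3 8
        + torsion 3 0 1 p * ?w 0 1 + torsion 3 0 2 p * ?w 0 2 - torsion 3 0 3 p * ?w 0 3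
        + torsion 3 0 4 p * ?w 0 4 \<and>
      ext_d (Theta 4) p u v = 6 * ?w 0 12 + 3 * ?w 3 6 - 3 * ?w 4 5 + 3 * ?w 4 8"
    unfolding Th by blast
qed

section \<open>Normalization of \<open>d\<theta>\<^sup>5\<close>\<close>

lemma ext_d_theta5_fibre:
  assumes p: "p \<in> G"
  shows "ext_d theta5 p (fibre_vector 12 p) (frame 1 p) = 1"
proof -
  define \<phi> where "\<phi> = (\<lambda>q :: pt9. 1 / (2 * fibre_\<delta> q))"
  have nz: "fibre_\<delta> p \<noteq> 0" "fibre_s5 p \<noteq> 0" using G9_nonzero[OF p] by auto
  have dh: "(h5 j has_derivative frechet_derivative (h5 j) (at p)) (at p)" for j
    using smooth_on_differentiable[OF smooth_h5 p] by (simp add: frechet_derivative_works)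
  have d\<delta>: "(fibre_\<delta> has_derivative fibre_\<delta>) (at p)"
    "(fibre_s4 has_derivative fibre_s4) (at p)"
    by (intro bounded_linear_imp_has_derivative bounded_linear_fibre)+
  have d\<phi>: "(\<phi> has_derivative (\<lambda>u. - (fibre_\<delta> u) / (2 * (fibre_\<delta> p)^2))) (at p)"
    unfolding \<phi>_def
    by (rule d\<delta> derivative_eq_intros refl)+ (use nz in \<open>simp_all add: field_simps eval_nat_numeral\<close>)
  have f5: "fibre_form 5 = (\<lambda>q. \<phi> q *\<^sub>R Blinfun fibre_\<delta>)"
    by (simp add: fibre_form_def[abs_def] \<phi>_def Let_def)
  have fv: "fibre_\<delta> (fibre_vector 12 p) = 0" "fibre_s4 (fibre_vector 12 p) = 6 * (fibre_\<delta> p)^3"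
    by (simp_all add: fibre_vector_def Let_def)
  \<comment> \<open>\<open>fibre_form 5\<close> is a function of \<open>\<delta>\<close> times
    \<open>d\<delta>\<close>, and \<open>\<delta>\<close> does not change along
    \<open>fibre_vector 12\<close>.\<close>
  have "ext_d (\<lambda>q. \<phi> q *\<^sub>R Blinfun fibre_\<delta>) p (fibre_vector 12 p) (frame 1 p) = 0"
    by (simp add: ext_d_scaleR[OF d\<phi> differentiable_const] fv
        bounded_linear_Blinfun_apply bounded_linear_fibre ext_d_has_derivative[OF has_derivative_const])
  moreover have dfibre: "fibre_form 5 differentiable (at p)"
    by (rule smooth_on_differentiable[OF smooth_on_fibre_form[OF open_U] p])
  ultimately have e5: "ext_d (fibre_form 5) p (fibre_vector 12 p) (frame 1 p) = 0"
    by (simp add: f5)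
  have frame_th: "blinfun_apply (th j p) (frame 1 p) = (if j = 1 then 1 else 0)" if "j \<le> 4" for j
    using that by (simp add: frame_def blinfun.bilinear_simps theta_base_vector[OF p] theta_fibre_vector)
  \<comment> \<open>With the \<open>d\<theta>\<^sup>j\<close> contributing nothing, only the
    derivative of the coefficient \<open>h5 1\<close> of \<open>\<theta>\<^sup>1\<close> is
    left.\<close>
  have eth: "ext_d (th j) p (fibre_vector 12 p) (frame 1 p) = 0" if "j \<le> 4" for j
    using that p
    by (simp add: frame_def ext_d_bilinear[OF diff_theta] ext_d_fibre_F C_def fibre_action_def)
  have dsc: "(\<lambda>q. h5 j q *\<^sub>R th j q) differentiable (at p)" if "j \<le> 4" for j
    by (rule smooth_on_differentiable[OF _ p], intro smooth_intros open_G smooth_h5 smooth_theta that)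
  have "ext_d (\<lambda>q. h5 j q *\<^sub>R th j q) p (fibre_vector 12 p) (frame 1 p) =
      (if j = 1 then frechet_derivative (h5 1) (at p) (fibre_vector 12 p) else 0)" if "j \<le> 4" for j
    using that
    by (simp add: ext_d_scaleR[OF dh diff_theta[OF that p]] frame_th eth theta_fibre_vector
        del: One_nat_def)
  moreover have "ext_d theta5 p (fibre_vector 12 p) (frame 1 p) =
      (\<Sum>j\<le>4. ext_d (\<lambda>q. h5 j q *\<^sub>R th j q) p (fibre_vector 12 p) (frame 1 p))"
  proof -
    have "ext_d (\<lambda>q. \<Sum>j\<le>4. h5 j q *\<^sub>R th j q) p (fibre_vector 12 p) (frame 1 p) =
        (\<Sum>j\<le>4. ext_d (\<lambda>q. h5 j q *\<^sub>R th j q) p (fibre_vector 12 p) (frame 1 p))"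
      by (rule ext_d_sum) (use dsc in auto)
    moreover have "(\<lambda>q. \<Sum>j\<le>4. h5 j q *\<^sub>R th j q) differentiable (at p)"
      using dsc by (intro differentiable_sum) auto
    ultimately show ?thesis
      unfolding theta5_def[abs_def] by (simp only: ext_d_add[OF dfibre] e5 add_0)
  qed
  ultimately have "ext_d theta5 p (fibre_vector 12 p) (frame 1 p) =
      (\<Sum>j\<le>(4::nat). if j = 1 then frechet_derivative (h5 1) (at p) (fibre_vector 12 p) else 0)"
    by (simp del: One_nat_def)
  also have "\<dots> = frechet_derivative (h5 1) (at p) (fibre_vector 12 p)"
    by simp
  also have "\<dots> = 1"
  proof -
    \<comment> \<open>Along \<open>fibre_vector 12\<close> the coordinate \<open>s\<^sub>4\<close>
      changes at the rate \<open>6 * \<delta>^3\<close>, the denominator here, which gives the value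
      1.\<close>
    have "h5 1 q = fibre_s4 q / (6 * (fibre_\<delta> q)^3)" if "q \<in> G" for q
      using ext_d_base[OF that, of 0 0 1] base_torsion_values(1)[OF G9_nonzero(1,2)[OF that]]
      by (simp add: h5_def R_def)
    moreover have "((\<lambda>q. fibre_s4 q / (6 * (fibre_\<delta> q)^3)) has_derivative
        (\<lambda>u. fibre_s4 u / (6 * (fibre_\<delta> p)^3) - fibre_s4 p * fibre_\<delta> u / (2 * (fibre_\<delta> p)^4))) (at p)"
      by (rule d\<delta> derivative_eq_intros refl)+
        (use nz in \<open>simp_all add: fun_eq_iff field_simps eval_nat_numeral\<close>)
    ultimately have "(h5 1 has_derivative
        (\<lambda>u. fibre_s4 u / (6 * (fibre_\<delta> p)^3) - fibre_s4 p * fibre_\<delta> u / (2 * (fibre_\<delta> p)^4))) (at p)"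
      by (intro has_derivative_transform_within_open[OF _ open_G p, of
          "\<lambda>q. fibre_s4 q / (6 * (fibre_\<delta> q)^3)" _ UNIV "h5 1"]) auto
    from frechet_derivative_at[OF this, symmetric] show ?thesis
      using nz by (simp add: fv)
  qed
  finally show ?thesis .
qed

text \<open>\<open>h12 0\<close> is the value of \<open>d\<theta>\<^sup>5\<close> on
  \<open>base_vector 0\<close> and \<open>frame 1\<close>. Passing from \<open>base_vector 0\<close>
  to \<open>frame 0\<close> subtracts exactly this value, by
  \<open>ext_d_theta5_fibre\<close>.\<close>

lemma ext_d_theta5_frame:
  assumes p: "p \<in> G"
  shows "ext_d theta5 p (frame 0 p) (frame 1 p) = 0"
proof -
  have "theta5 differentiable (at p)"
    by (rule smooth_on_differentiable[OF smooth_theta568(1) p])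
  moreover have "h12 0 p = ext_d theta5 p (base_vector 0 p) (frame 1 p)"
    by (simp add: h12_def frame_def Let_def)
  ultimately show ?thesis
    using ext_d_theta5_fibre[OF p]
    by (subst frame_def) (simp add: ext_d_bilinear)
qed

section \<open>Existence and uniqueness of the normalized coframe\<close>

lemma normalized_Theta: "normalized_coframe U \<omega> a b c J Theta"
  unfolding normalized_coframe_def
proof (intro conjI)
  show "coframe_on G I9 Theta"
    unfolding coframe_on_def
    using smooth_Theta dual_frame_imp_basis[OF finite_I9 frame_dual] by blast
  show "\<forall>i\<in>{0..4}. \<forall>p\<in>G. Theta i p = th i p"
    by (simp add: Theta_def)
  show "\<exists>T. (\<forall>i j k. smooth_on G (T i j k)) \<and> structure_equations G Theta T"
    using smooth_torsion structure_equations_Theta by blast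
  have "Theta 5 = theta5" by (simp add: Theta_def)
  then show "zero_coeff_01 G Theta (ext_d (Theta 5))"
    using zero_coeff_01_iff[of G Theta frame] frame_dual ext_d_theta5_frame
      smooth_on_differentiable[OF smooth_Theta[of 5]] by simp
qed

lemma normalized_unique:
  assumes n: "normalized_coframe U \<omega> a b c J \<theta>'" and "i \<in> I9" "p \<in> G"
  shows "\<theta>' i p = Theta i p"
proof -
  obtain T' where T': "structure_equations G \<theta>' T'"
    using n by (auto simp: normalized_coframe_def)
  show ?thesis
  proof (rule normalized_forms_unique[OF open_G structure_equations_Theta T'])
    show "\<theta>' i q = Theta i q" if "i \<in> {0..4}" "q \<in> G" for i q
      using n that by (simp add: normalized_coframe_def Theta_def)
    show "Theta i differentiable (at q)" if "q \<in> G" for i q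
      by (rule smooth_on_differentiable[OF smooth_Theta that])
    show "dual_frame I9 (\<lambda>i. Theta i q) (\<lambda>i. frame i q)" if "q \<in> G" for q
      by (rule frame_dual[OF that])
    show "ext_d (Theta 5) q (frame 12 q) (frame 1 q) \<noteq> 0" if "q \<in> G" for q
      using ext_d_theta5_fibre[OF that] by (simp add: Theta_def frame_def[of 12])
  qed (use assms normalized_Theta in \<open>auto simp: normalized_coframe_def\<close>)
qed

end

theorem proposition10:
  fixes U :: "(real^5) set"
    and C K L :: "real^5 \<Rightarrow> (real^5) set"
    and \<omega> :: "nat \<Rightarrow> (real^5) one_form"
    and a b c J M P :: "real^5 \<Rightarrow> real"
  assumes "marked_contact_engel U C K L"
    and "adapted_coframe U C K L \<omega>"
    and "smooth_on U a" "smooth_on U b" "smooth_on U c"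
    and "smooth_on U J" "smooth_on U M" "smooth_on U P"
    and "SE U \<omega> a b c J M P"
  shows "\<exists>\<theta>. normalized_coframe U \<omega> a b c J \<theta> \<and>
           (\<forall>\<theta>'. normalized_coframe U \<omega> a b c J \<theta>' \<longrightarrow>
              (\<forall>i\<in>I9. \<forall>p\<in>G9 U. \<theta>' i p = \<theta> i p))"
proof -
  interpret engel_coframe U \<omega> a b c J M P
  proof
    show "open U"
      using assms(1) by (simp add: marked_contact_engel_def contact_twisted_cubic_def)
    show "coframe_on U {..4} \<omega>"
      using assms(2) by (simp add: adapted_coframe_def)
  qed (use assms in auto)
  show ?thesis
    using normalized_Theta normalized_unique by blast
qed

end
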